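(* Let $Z=[z_0:z_1:\cdots:z_n]$ be the homogeneous coordinate system of $\mathbb{C}\mathbb{P}^n$, and let $$\Lambda=\sum_{\alpha,\beta}\overleftarrow{\partial_{Z_\alpha}}\,\Lambda^{\alpha,\beta}\,\overrightarrow{\partial_{Z_\beta}}$$ define a holomorphic skew-symmetric biderivation of order zero acting on the structure sheaf $\mathcal{O}_{\mathbb{C}\mathbb{P}^n}$ and satisfying the Jacobi rule. Assume moreover that for every $k\ge1$ (summation over repeated indices) $$\bigl(\overleftarrow{\partial_{Z_{\alpha_1}}}\Lambda^{\alpha_1,\beta_1}\overrightarrow{\partial_{Z_{\beta_1}}}\bigr)\cdots\bigl(\overleftarrow{\partial_{Z_{\alpha_k}}}\Lambda^{\alpha_k,\beta_k}\overrightarrow{\partial_{Z_{\beta_k}}}\bigr)=\overleftarrow{\partial_{Z_{\alpha_1\ldots\alpha_k}}}\,\Lambda^{\alpha_1,\beta_1}\cdots\Lambda^{\alpha_k,\beta_k}\,\overrightarrow{\partial_{Z_{\beta_1\ldots\beta_k}}}.$$ Then the product $$f(Z)\# g(Z):=\sum_{k=0}^\infty\frac{1}{k!}\Bigl(\frac{\mu}{2}\Bigr)^k\Lambda^{\alpha_1\beta_1}\cdots\Lambda^{\alpha_k\beta_k}\,\partial_{Z_{\alpha_1}}\cdots\partial_{Z_{\alpha_k}}f(Z)\;\partial_{Z_{\beta_1}}\cdots\partial_{Z_{\beta_k}}g(Z)$$ induces a globally defined non-commutative, associative product on the sheaf-cohomology space $$\sum_{k=0}^\infty H^0(\mathbb{C}\mathbb{P}^n,\mathcal{O}_{\mathbb{C}\mathbb{P}^n}(k))[[\natural]],$$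 where $\mu$ can be specialized to a scalar (for example $\mu=1$).
   Context: Indices $\alpha,\beta,\alpha_i,\beta_i$ run over $0,\dots,n$; $Z_\alpha=z_\alpha$; repeated indices are summed (Einstein convention). Local sections of $\mathcal{O}_{\mathbb{C}\mathbb{P}^n}(k)$ are represented by holomorphic functions of $Z$ homogeneous of degree $k$; $H^0(\mathbb{C}\mathbb{P}^n,\mathcal{O}_{\mathbb{C}\mathbb{P}^n}(k))$ is identified with the space $\mathbb{C}[Z]_k$ of homogeneous polynomials of degree $k$ in $z_0,\dots,z_n$. The biderivation $\Lambda$ acts by $f\,\Lambda\,g=\Lambda^{\alpha,\beta}(Z)\,\partial_{Z_\alpha}f\,\partial_{Z_\beta}g$, with holomorphic coefficients $\Lambda^{\alpha,\beta}=-\Lambda^{\beta,\alpha}$. "Of order zero" means that it preserves degrees of homogeneity (the globally defined coefficients $\Lambda^{\alpha,\beta}$ are homogeneous of degree $2$ in $Z$). The Jacobi rule means that $\{f,g\}:=f\Lambda g$ satisfies the Jacobi identity. Arrow notation: $f\,\overleftarrow{\partial_{Z_{\alpha_1\ldots\alpha_k}}}$ means $\partial_{Z_{\alpha_1}}\cdots\partial_{Z_{\alpha_k}}f$, and $\overrightarrow{\partial_{Z_{\beta_1\ldots\beta_k}}}\,g$ means $\partial_{Z_{\beta_1}}\cdots\partial_{Z_{\beta_k}}g$. In the left-hand side of the displayed assumption, the factors are written one after another between $f$ (on the far left) and $g$ (on the far right), and each left (right) arrow differentiates everything standing to its left (right), including the coefficients of the other factors. The assumption is an equality of bidifferential operators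 in $Z$. $[[\natural]]$ denotes adjoining the formal parameter $\mu$: either $[\mu,\mu^{-1}]]$ (formal Laurent series in $\mu$ with finitely many negative powers) or $[\mu,\mu^{-1}]$ (Laurent polynomials), chosen so that the expressions make sense; for the specialization of $\mu$ to a (nonzero) scalar one uses $[\mu,\mu^{-1}]$. The product $\#$ is extended bilinearly over the $\mu$-coefficients. "Non-commutative" is meant in the usual sense of "not necessarily commutative". *)

theory Defs
  imports
    "HOL-Analysis.Analysis"
    "HOL-Library.Function_Algebras"
    "HOL-Computational_Algebra.Formal_Laurent_Series"
begin

notation fls_nth (infixl \<open>$$\<close> 75)

text \<open>
  The index type \<open>'n\<close> stands for \<open>{0,\<dots>,n}\<close>, so that \<open>complex ^ 'n\<close> is the space of homogeneous
  coordinate vectors of projective \<open>n\<close>-space. Open subsets of projective space are represented by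
  their preimages in \<open>- {0}\<close>, i.e. by the open cones.
\<close>

section \<open>Functions of the homogeneous coordinates\<close>

definition pd :: "'n \<Rightarrow> (complex ^ 'n \<Rightarrow> complex) \<Rightarrow> complex ^ 'n \<Rightarrow> complex" where
  "pd a f z = deriv (\<lambda>t. f (z + axis a t)) 0"

definition pds :: "'n list \<Rightarrow> (complex ^ 'n \<Rightarrow> complex) \<Rightarrow> complex ^ 'n \<Rightarrow> complex" where
  "pds as f = foldr pd as f"

definition holomorphic_sev :: "(complex ^ 'n \<Rightarrow> complex) \<Rightarrow> (complex ^ 'n) set \<Rightarrow> bool" where
  "holomorphic_sev f V \<longleftrightarrow>
     (\<forall>z\<in>V. \<exists>c. (f has_derivative (\<lambda>h. \<Sum>a\<in>UNIV. c a * h $ a)) (at z))"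

definition open_cone :: "(complex ^ 'n) set \<Rightarrow> bool" where
  "open_cone V \<longleftrightarrow> open V \<and> 0 \<notin> V \<and> (\<forall>z\<in>V. \<forall>t. t \<noteq> 0 \<longrightarrow> t *s z \<in> V)"

definition sections :: "int \<Rightarrow> (complex ^ 'n) set \<Rightarrow> (complex ^ 'n \<Rightarrow> complex) set" where
  "sections k V =
     {f. holomorphic_sev f V \<and> (\<forall>z\<in>V. \<forall>t. t \<noteq> 0 \<longrightarrow> f (t *s z) = t powi k * f z)}"

text \<open>
  A global section is a function on \<open>- {0}\<close>. As functions in HOL are total, it has to be given a value
  at the origin; continuity makes this choice unique (\<open>k \<ge> 0\<close>), and it turns the global sections into
  the homogeneous polynomial functions of degree \<open>k\<close>.
\<close>

definition H0 :: "nat \<Rightarrow> (complex ^ 'n \<Rightarrow> complex) set" where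
  "H0 k = {f \<in> sections (int k) (- {0}). isCont f 0}"

definition sum_H0 :: "(complex ^ 'n \<Rightarrow> complex) set" where
  "sum_H0 = {f. \<exists>N h. (\<forall>k\<le>N. h k \<in> H0 k) \<and> f = (\<lambda>z. \<Sum>k\<le>N. h k z)}"

section \<open>Bidifferential operators\<close>

definition bracket ::
  "('n \<Rightarrow> 'n \<Rightarrow> complex ^ 'n \<Rightarrow> complex) \<Rightarrow>
   (complex ^ 'n \<Rightarrow> complex) \<Rightarrow> (complex ^ 'n \<Rightarrow> complex) \<Rightarrow> complex ^ 'n \<Rightarrow> complex" where
  "bracket L f g = (\<lambda>z. \<Sum>a\<in>UNIV. \<Sum>b\<in>UNIV. L a b z * pd a f z * pd b g z)"

definition jacobi :: "('n \<Rightarrow> 'n \<Rightarrow> complex ^ 'n \<Rightarrow> complex) \<Rightarrow> bool" where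
  "jacobi L \<longleftrightarrow>
     (\<forall>V j k l. \<forall>f\<in>sections j V. \<forall>g\<in>sections k V. \<forall>h\<in>sections l V. \<forall>z\<in>V. open_cone V \<longrightarrow>
        bracket L f (bracket L g h) z + bracket L g (bracket L h f) z
          + bracket L h (bracket L f g) z = 0)"

text \<open>
  A word in the arrow notation is a product of functions \<open>hs ! 0, hs ! 1, \<dots>\<close> together with arrows; an
  entry \<open>(p, a, b)\<close> is a pair of arrows attached to position \<open>p\<close>: a left arrow for the coordinate
  \<open>a\<close> and a right arrow for the coordinate \<open>b\<close>. The left arrow differentiates the product of
  everything at the positions \<open>i < p\<close>, the right arrow the product of everything at the positions
  \<open>j > p\<close>. Arrows at different positions act across each other, so their action is not a
  composition of operators on functions; it is given by the product rule, which distributes each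
  arrow over the factors it acts on. The partial derivatives commute on holomorphic functions, hence
  the order in which the arrows are processed does not matter.
\<close>

fun arrows ::
  "(nat \<times> 'n \<times> 'n) list \<Rightarrow> (complex ^ 'n \<Rightarrow> complex) list \<Rightarrow> complex ^ 'n \<Rightarrow> complex" where
  "arrows [] hs z = (\<Prod>h\<leftarrow>hs. h z)"
| "arrows ((p, a, b) # ws) hs z =
     (\<Sum>i<p. \<Sum>j\<in>{p<..<length hs}. arrows ws (hs[i := pd a (hs ! i), j := pd b (hs ! j)]) z)"

definition iterated_op ::
  "('n \<Rightarrow> 'n \<Rightarrow> complex ^ 'n \<Rightarrow> complex) \<Rightarrow> nat \<Rightarrow>
   (complex ^ 'n \<Rightarrow> complex) \<Rightarrow> (complex ^ 'n \<Rightarrow> complex) \<Rightarrow> complex ^ 'n \<Rightarrow> complex" where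
  "iterated_op L k f g = (\<lambda>z. \<Sum>as | length as = k. \<Sum>bs | length bs = k.
     arrows (zip [1..<Suc k] (zip as bs)) (f # map2 L as bs @ [g]) z)"

definition normal_op ::
  "('n \<Rightarrow> 'n \<Rightarrow> complex ^ 'n \<Rightarrow> complex) \<Rightarrow> nat \<Rightarrow>
   (complex ^ 'n \<Rightarrow> complex) \<Rightarrow> (complex ^ 'n \<Rightarrow> complex) \<Rightarrow> complex ^ 'n \<Rightarrow> complex" where
  "normal_op L k f g = (\<lambda>z. \<Sum>as | length as = k. \<Sum>bs | length bs = k.
     (\<Prod>i<k. L (as ! i) (bs ! i) z) * pds as f z * pds bs g z)"

section \<open>The star product\<close>

definition star_coeff ::
  "('n \<Rightarrow> 'n \<Rightarrow> complex ^ 'n \<Rightarrow> complex) \<Rightarrow> nat \<Rightarrow>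
   (complex ^ 'n \<Rightarrow> complex) \<Rightarrow> (complex ^ 'n \<Rightarrow> complex) \<Rightarrow> complex ^ 'n \<Rightarrow> complex" where
  "star_coeff L k f g = (\<lambda>z. 1 / fact k * (1 / 2) ^ k * normal_op L k f g z)"

text \<open>The indeterminate of the formal Laurent series is the parameter \<open>\<mu>\<close>.\<close>

definition star ::
  "('n \<Rightarrow> 'n \<Rightarrow> complex ^ 'n \<Rightarrow> complex) \<Rightarrow>
   (complex ^ 'n \<Rightarrow> complex) \<Rightarrow> (complex ^ 'n \<Rightarrow> complex) \<Rightarrow> (complex ^ 'n \<Rightarrow> complex) fls" where
  "star L f g = fps_to_fls (Abs_fps (\<lambda>k. star_coeff L k f g))"

text \<open>
  The bilinear extension: the coefficient of \<open>\<mu>\<^sup>m\<close> collects the terms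
  \<open>\<mu>\<^sup>i \<mu>\<^sup>j (F\<^sub>i # G\<^sub>j)\<close>; the bounds only remove indices whose terms vanish.
\<close>

definition star_ext ::
  "('n \<Rightarrow> 'n \<Rightarrow> complex ^ 'n \<Rightarrow> complex) \<Rightarrow> (complex ^ 'n \<Rightarrow> complex) fls \<Rightarrow>
   (complex ^ 'n \<Rightarrow> complex) fls \<Rightarrow> (complex ^ 'n \<Rightarrow> complex) fls" where
  "star_ext L F G = Abs_fls (\<lambda>m.
     \<Sum>i\<in>{fls_subdegree F..m - fls_subdegree G}. \<Sum>j\<in>{fls_subdegree G..m - i}.
       star L (F $$ i) (G $$ j) $$ (m - i - j))"

lemma star_ext_nth:
  "star_ext L F G $$ m =
     (\<Sum>i\<in>{fls_subdegree F..m - fls_subdegree G}. \<Sum>j\<in>{fls_subdegree G..m - i}.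
        star L (F $$ i) (G $$ j) $$ (m - i - j))"
  unfolding star_ext_def
  by (rule nth_Abs_fls_lower_bound[of "fls_subdegree F + fls_subdegree G"]) simp

definition star_at ::
  "('n \<Rightarrow> 'n \<Rightarrow> complex ^ 'n \<Rightarrow> complex) \<Rightarrow> complex \<Rightarrow>
   (complex ^ 'n \<Rightarrow> complex) \<Rightarrow> (complex ^ 'n \<Rightarrow> complex) \<Rightarrow> complex ^ 'n \<Rightarrow> complex" where
  "star_at L c f g = (\<lambda>z. \<Sum>k. 1 / fact k * (c / 2) ^ k * normal_op L k f g z)"

section \<open>Adjoining the formal parameter\<close>

definition laurent_series :: "'a::zero set \<Rightarrow> 'a fls set" where
  "laurent_series A = {F. \<forall>m. F $$ m \<in> A}"

definition laurent_polys :: "'a::zero set \<Rightarrow> 'a fls set" where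
  "laurent_polys A = {F \<in> laurent_series A. finite {m. F $$ m \<noteq> 0}}"

definition eval_at :: "complex \<Rightarrow> (complex ^ 'n \<Rightarrow> complex) fls \<Rightarrow> complex ^ 'n \<Rightarrow> complex" where
  "eval_at c F = (\<lambda>z. \<Sum>m | F $$ m \<noteq> 0. c powi m * (F $$ m) z)"

definition fscale :: "complex \<Rightarrow> ('a \<Rightarrow> complex) \<Rightarrow> 'a \<Rightarrow> complex" where
  "fscale c f = (\<lambda>z. c * f z)"

text \<open>Scalar Laurent series act through the Laurent series with constant functions as coefficients.\<close>

definition lscale :: "complex fls \<Rightarrow> ('a \<Rightarrow> complex) fls \<Rightarrow> ('a \<Rightarrow> complex) fls" where
  "lscale c F = Abs_fls (\<lambda>m z. c $$ m) * F"

lemma const_fls_nth: "Abs_fls (\<lambda>m (z::'a). c $$ m) $$ m = (\<lambda>z. (c :: complex fls) $$ m)"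
  by (rule nth_Abs_fls_lower_bound[of "fls_subdegree c"]) (simp add: zero_fun_def)

definition bilinear_assoc_on ::
  "'s set \<Rightarrow> ('s \<Rightarrow> 'a::plus \<Rightarrow> 'a) \<Rightarrow> 'a set \<Rightarrow> ('a \<Rightarrow> 'a \<Rightarrow> 'a) \<Rightarrow> bool" where
  "bilinear_assoc_on S sc A P \<longleftrightarrow>
     (\<forall>x\<in>A. \<forall>y\<in>A. P x y \<in> A) \<and>
     (\<forall>x\<in>A. \<forall>y\<in>A. \<forall>w\<in>A. P (x + y) w = P x w + P y w \<and> P w (x + y) = P w x + P w y) \<and>
     (\<forall>c\<in>S. \<forall>x\<in>A. \<forall>y\<in>A. P (sc c x) y = sc c (P x y) \<and> P x (sc c y) = sc c (P x y)) \<and>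
     (\<forall>x\<in>A. \<forall>y\<in>A. \<forall>w\<in>A. P (P x y) w = P x (P y w))"

end

theory Submission
  imports Defs "HOL-Complex_Analysis.Complex_Analysis"
begin

text \<open>
  A continuous global section is polynomial: by Liouville's theorem it is polynomial in each variable
  separately, and Lagrange interpolation in each variable then makes it polynomial. So everything
  happens in the ring of polynomial functions.

  Put \<open>T\<^sup>p\<^sup>q\<^sup>c = \<Lambda>\<^sup>p\<^sup>b \<partial>\<^sub>b \<Lambda>\<^sup>q\<^sup>c\<close>. Comparing symbols in the assumption for \<open>k = 2\<close> shows that
  \<open>T\<close> is antisymmetric in \<open>p, q\<close>; it is antisymmetric in \<open>q, c\<close> because \<open>\<Lambda>\<close> is skew. The
  Jacobi identity for the coordinate functions says that the cyclic sum of \<open>T\<close> vanishes, and for a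
  totally antisymmetric tensor this sum is \<open>3 T\<close>. Hence \<open>T = 0\<close>: the coefficients are Casimir
  functions and can be pulled out of all operators as if they were constant. As for the Moyal
  product, both bracketings of a triple product then have the coefficients
  \<open>(\<Lambda>\<^sub>1\<^sub>2 + \<Lambda>\<^sub>1\<^sub>3 + \<Lambda>\<^sub>2\<^sub>3)\<^sup>r / (2\<^sup>r r!)\<close>, where \<open>\<Lambda>\<^sub>i\<^sub>j\<close> lets \<open>\<Lambda>\<close> act on
  the factors \<open>i\<close> and \<open>j\<close>.
\<close>

section \<open>Polynomial functions\<close>

no_notation fps_nth (infixl "$" 75)

lemma sum_fun_apply: "(\<Sum>i\<in>A. F i) x = (\<Sum>i\<in>A. F i x)"
  for F :: "'i \<Rightarrow> 'a \<Rightarrow> 'b::comm_monoid_add"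
  by (induction A rule: infinite_finite_induct) simp_all

text \<open>Polynomials are taken as functions, since \<open>pd\<close> and the bidifferential
  operators act on functions. Induction over the ring structure then takes the place of a normal
  form.\<close>

inductive_set cpoly :: "(complex ^ 'n::finite \<Rightarrow> complex) set" where
  const: "(\<lambda>z. c) \<in> cpoly"
| coord: "(\<lambda>z. z $ a) \<in> cpoly"
| add: "f \<in> cpoly \<Longrightarrow> g \<in> cpoly \<Longrightarrow> f + g \<in> cpoly"
| mult: "f \<in> cpoly \<Longrightarrow> g \<in> cpoly \<Longrightarrow> f * g \<in> cpoly"

lemma cpoly_add: "f \<in> cpoly \<Longrightarrow> g \<in> cpoly \<Longrightarrow> f + g \<in> cpoly"
  and cpoly_mult: "f \<in> cpoly \<Longrightarrow> g \<in> cpoly \<Longrightarrow> f * g \<in> cpoly"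
  by (rule cpoly.add cpoly.mult; assumption)+

text \<open>Keeps the sum and product cases in the form \<open>f + g\<close> and
  \<open>f * g\<close>, which is what \<open>pd_add\<close> and \<open>pd_mult\<close>
  rewrite.\<close>

lemma cpoly_induct [consumes 1, case_names const coord add mult, induct set: cpoly]:
  assumes "f \<in> cpoly"
    and "\<And>c. P (\<lambda>z. c)" and "\<And>a. P (\<lambda>z. z $ a)"
    and "\<And>f g. f \<in> cpoly \<Longrightarrow> P f \<Longrightarrow> g \<in> cpoly \<Longrightarrow> P g \<Longrightarrow> P (f + g)"
    and "\<And>f g. f \<in> cpoly \<Longrightarrow> P f \<Longrightarrow> g \<in> cpoly \<Longrightarrow> P g \<Longrightarrow> P (f * g)"
  shows "P f"
  using assms by (rule cpoly.induct) (simp_all add: plus_fun_def times_fun_def)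

lemma cpoly_0: "0 \<in> cpoly"
  using cpoly.const[of 0] by (simp add: zero_fun_def)

lemma cpoly_sum: "(\<And>i. i \<in> A \<Longrightarrow> F i \<in> cpoly) \<Longrightarrow> (\<Sum>i\<in>A. F i) \<in> cpoly"
  by (induction A rule: infinite_finite_induct) (auto intro: cpoly_0 cpoly_add)

lemma cpoly_uminus: "f \<in> cpoly \<Longrightarrow> - f \<in> cpoly"
  using cpoly_mult[OF cpoly.const[of "-1"]] by (fastforce simp: times_fun_def fun_Compl_def)

lemma cpoly_poly_coord: "(\<lambda>z. poly p (z $ a)) \<in> cpoly"
proof (induction p)
  case 0
  then show ?case by (simp add: cpoly.const)
next
  case (pCons c p)
  have "(\<lambda>z::complex^'a. c) + (\<lambda>z. z $ a) * (\<lambda>z. poly p (z $ a)) \<in> cpoly"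
    by (intro cpoly.const cpoly.coord cpoly_add cpoly_mult pCons)
  then show ?case by (simp add: plus_fun_def times_fun_def)
qed

section \<open>Partial derivatives of polynomial functions\<close>

lemma cpoly_field_differentiable:
  "f \<in> cpoly \<Longrightarrow> (\<lambda>t. f (z + axis a t)) field_differentiable at t0"
proof (induction rule: cpoly_induct)
  case (coord b)
  then show ?case by (cases "a = b") (auto simp: axis_def intro!: derivative_intros)
qed (auto intro: derivative_intros simp: plus_fun_def times_fun_def)

lemma pd_const: "pd a (\<lambda>z. c) = 0"
  by (simp add: pd_def zero_fun_def fun_eq_iff)

lemma pd_0 [simp]: "pd a 0 = 0"
  using pd_const[of a 0] by (simp add: zero_fun_def)

lemma pd_coord: "pd a (\<lambda>z. z $ b) = (\<lambda>z. if a = b then 1 else 0)"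
proof
  fix z :: "complex ^ 'a"
  have "deriv (\<lambda>t. z $ b + (if a = b then t else 0)) 0 = (if a = b then 1 else 0)"
    by (cases "a = b") (auto intro!: DERIV_imp_deriv derivative_eq_intros)
  then show "pd a (\<lambda>z. z $ b) z = (if a = b then 1 else 0)"
    by (simp add: pd_def axis_def eq_commute)
qed

lemma pd_add: "f \<in> cpoly \<Longrightarrow> g \<in> cpoly \<Longrightarrow> pd a (f + g) = pd a f + pd a g"
  by (rule ext) (simp add: pd_def cpoly_field_differentiable)

lemma axis_0 [simp]: "axis a 0 = 0"
  by (simp add: axis_def vec_eq_iff)

lemma pd_mult: "f \<in> cpoly \<Longrightarrow> g \<in> cpoly \<Longrightarrow> pd a (f * g) = pd a f * g + f * pd a g"
  by (rule ext) (simp add: pd_def cpoly_field_differentiable)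

lemma pd_cpoly: "f \<in> cpoly \<Longrightarrow> pd a f \<in> cpoly"
proof (induction rule: cpoly_induct)
  case (add f g)
  then show ?case by (simp add: pd_add cpoly_add del: plus_fun_apply times_fun_apply)
next
  case (mult f g)
  then show ?case by (simp add: pd_mult cpoly_add cpoly_mult del: plus_fun_apply times_fun_apply)
qed (simp_all add: pd_const pd_coord cpoly.const cpoly_0)

lemma pd_uminus: "f \<in> cpoly \<Longrightarrow> pd a (- f) = - pd a f"
  using pd_add[of f "-f" a] by (simp add: cpoly_uminus eq_neg_iff_add_eq_0 add.commute)

lemma pd_sum:
  "(\<And>i. i \<in> A \<Longrightarrow> F i \<in> cpoly) \<Longrightarrow> pd a (\<Sum>i\<in>A. F i) = (\<Sum>i\<in>A. pd a (F i))"
  by (induction A rule: infinite_finite_induct) (simp_all add: pd_add cpoly_sum)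

text \<open>By induction over the ring structure: in the product case the mixed terms of the two
  product rules match in pairs.\<close>

lemma pd_commute: "f \<in> cpoly \<Longrightarrow> pd a (pd b f) = pd b (pd a f)"
proof (induction rule: cpoly_induct)
  case (coord c)
  then show ?case by (simp add: pd_coord pd_const)
next
  case (add f g)
  then show ?case by (simp add: pd_add pd_cpoly del: plus_fun_apply times_fun_apply)
next
  case (mult f g)
  then show ?case by (simp add: pd_add pd_mult pd_cpoly cpoly_mult algebra_simps del: plus_fun_apply times_fun_apply)
qed (simp add: pd_const)

lemma pds_Nil [simp]: "pds [] f = f" and pds_Cons [simp]: "pds (a # as) f = pd a (pds as f)"
  by (simp_all add: pds_def)

lemma pds_cpoly: "f \<in> cpoly \<Longrightarrow> pds as f \<in> cpoly"
  by (induction as) (simp_all add: pd_cpoly)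

lemma pds_pd: "f \<in> cpoly \<Longrightarrow> pds as (pd a f) = pd a (pds as f)"
  by (induction as) (simp_all add: pd_commute pds_cpoly)

lemma cpoly_continuous: "f \<in> cpoly \<Longrightarrow> isCont f z"
proof (induction rule: cpoly_induct)
qed (auto simp: plus_fun_def times_fun_def intro!: continuous_intros)

lemma cpoly_holomorphic:
  assumes "f \<in> cpoly"
  shows "holomorphic_sev f V"
proof -
  have "\<exists>c. (f has_derivative (\<lambda>h. \<Sum>a\<in>UNIV. c a * h $ a)) (at z)" for z
    using assms
  proof (induction rule: cpoly_induct)
    case (const c)
    then show ?case by (auto intro!: exI[of _ "\<lambda>_. 0"])
  next
    case (coord b)
    have *: "(\<Sum>a\<in>UNIV. (if a = b then 1 else 0) * h $ a) = h $ b" for h :: "complex ^ 'a"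
      by (simp add: if_distrib[of "\<lambda>x. x * _"] cong: if_cong)
    have "((\<lambda>z. z $ b) has_derivative (\<lambda>h. h $ b)) (at z)"
      by (rule bounded_linear_imp_has_derivative[OF bounded_linear_vec_nth])
    then show ?case by (intro exI[of _ "\<lambda>a. if a = b then 1 else 0"]) (simp only: *)
  next
    case (add f g)
    then obtain c d where "(f has_derivative (\<lambda>h. \<Sum>a\<in>UNIV. c a * h $ a)) (at z)"
      "(g has_derivative (\<lambda>h. \<Sum>a\<in>UNIV. d a * h $ a)) (at z)" by blast
    from has_derivative_add[OF this] show ?case
      by (intro exI[of _ "\<lambda>a. c a + d a"]) (simp add: plus_fun_def sum.distrib distrib_right)
  next
    case (mult f g)
    then obtain c d where "(f has_derivative (\<lambda>h. \<Sum>a\<in>UNIV. c a * h $ a)) (at z)"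
      "(g has_derivative (\<lambda>h. \<Sum>a\<in>UNIV. d a * h $ a)) (at z)" by blast
    from has_derivative_mult[OF this] show ?case
      by (intro exI[of _ "\<lambda>a. f z * d a + c a * g z"])
        (simp add: times_fun_def sum.distrib distrib_left sum_distrib_left sum_distrib_right mult_ac)
  qed
  then show ?thesis by (simp add: holomorphic_sev_def)
qed

section \<open>Homogeneous polynomial functions\<close>

text \<open>
  The degree is an integer: a derivative then lowers it by one without a case distinction, and only
  \<open>0\<close> has negative degree.
\<close>

definition homog :: "int \<Rightarrow> (complex ^ 'n::finite \<Rightarrow> complex) set" where
  "homog d = {f \<in> cpoly. \<forall>t z. t \<noteq> 0 \<longrightarrow> f (t *s z) = t powi d * f z}"

lemma homogI: "f \<in> cpoly \<Longrightarrow> (\<And>t z. t \<noteq> 0 \<Longrightarrow> f (t *s z) = t powi d * f z) \<Longrightarrow> f \<in> homog d"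
  by (simp add: homog_def)

lemma homog_cpoly: "f \<in> homog d \<Longrightarrow> f \<in> cpoly"
  by (simp add: homog_def)

lemma homog_scale: "f \<in> homog d \<Longrightarrow> t \<noteq> 0 \<Longrightarrow> f (t *s z) = t powi d * f z"
  by (simp add: homog_def)

lemma homog_0: "0 \<in> homog d"
  by (simp add: homog_def cpoly_0)

lemma homog_add: "f \<in> homog d \<Longrightarrow> g \<in> homog d \<Longrightarrow> f + g \<in> homog d"
  by (rule homogI) (auto simp: homog_cpoly cpoly_add homog_scale distrib_left)

lemma homog_sum: "(\<And>i. i \<in> A \<Longrightarrow> F i \<in> homog d) \<Longrightarrow> (\<Sum>i\<in>A. F i) \<in> homog d"
  by (induction A rule: infinite_finite_induct) (auto intro: homog_0 homog_add)

lemma homog_mult: "f \<in> homog d \<Longrightarrow> g \<in> homog e \<Longrightarrow> f * g \<in> homog (d + e)"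
  by (rule homogI) (auto simp: homog_cpoly cpoly_mult homog_scale power_int_add)

lemma homog_const: "(\<lambda>z. c) \<in> homog 0"
  by (rule homogI) (auto intro: cpoly.const)

lemma homog_coord: "(\<lambda>z. z $ a) \<in> homog 1"
  by (rule homogI) (auto intro: cpoly.coord)

text \<open>A step of length \<open>s\<close> at \<open>t *s z\<close> is \<open>t\<close> times a
  step of length \<open>s / t\<close> at \<open>z\<close>. The chain rule therefore produces the
  factor \<open>1 / t\<close> that lowers the degree.\<close>

lemma homog_pd:
  assumes f: "f \<in> homog d"
  shows "pd a f \<in> homog (d - 1)"
proof (rule homogI)
  show "pd a f \<in> cpoly" using f by (simp add: homog_cpoly pd_cpoly)
  fix t :: complex and z :: "complex ^ 'a"
  assume t: "t \<noteq> 0"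
  have "f (t *s z + axis a s) = t powi d * f (z + axis a (s / t))" for s
  proof -
    have "t *s z + axis a s = t *s (z + axis a (s / t))"
      using t by (simp add: vec_eq_iff axis_def distrib_left)
    then show ?thesis using homog_scale[OF f t] by (simp only:)
  qed
  then have "pd a f (t *s z) = deriv (\<lambda>s. t powi d * f (z + axis a (s / t))) 0"
    by (simp add: pd_def)
  also have "\<dots> = t powi d * (pd a f z * (1 / t))"
  proof (rule DERIV_imp_deriv)
    have "((\<lambda>s. f (z + axis a s)) has_field_derivative pd a f z) (at (0 / t))"
      using cpoly_field_differentiable[OF homog_cpoly[OF f], of z a 0]
      by (simp add: pd_def field_differentiable_derivI)
    moreover have "((\<lambda>s. s / t) has_field_derivative (1 / t)) (at 0)"
      by (rule DERIV_cdivide) (rule DERIV_ident)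
    ultimately show "((\<lambda>s. t powi d * f (z + axis a (s / t))) has_field_derivative
        t powi d * (pd a f z * (1 / t))) (at 0)"
      by (intro DERIV_cmult) (rule DERIV_chain2)
  qed
  also have "\<dots> = t powi (d - 1) * pd a f z"
    using t by (simp add: power_int_diff)
  finally show "pd a f (t *s z) = t powi (d - 1) * pd a f z" .
qed

lemma homog_pds: "f \<in> homog d \<Longrightarrow> pds as f \<in> homog (d - int (length as))"
proof (induction as)
  case (Cons a as)
  then show ?case using homog_pd[of "pds as f" _ a] by (force simp: algebra_simps)
qed simp

lemma isCont_vector_scale: "isCont f 0 \<Longrightarrow> ((\<lambda>t. f (t *s z)) \<longlongrightarrow> f 0) (at 0)"
  for f :: "complex ^ 'n::finite \<Rightarrow> complex"
proof -
  assume "isCont f 0"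
  moreover have "((\<lambda>t. t *s z) \<longlongrightarrow> 0) (at 0)"
    by (rule vec_tendstoI) (auto intro!: tendsto_eq_intros)
  ultimately show ?thesis by (rule isCont_tendsto_compose)
qed

text \<open>For fixed \<open>z\<close> the function \<open>f (t *s z) * t ^ nat (- d)\<close> of
  \<open>t \<noteq> 0\<close> is constantly \<open>f z\<close>. It tends to 0 as \<open>t\<close>
  does, because \<open>f\<close> is continuous at the origin and the exponent is positive.\<close>

lemma homog_negative:
  assumes f: "f \<in> homog d" and d: "d < 0"
  shows "f = 0"
proof
  fix z
  have "((\<lambda>t. f (t *s z) * t ^ nat (- d)) \<longlongrightarrow> f 0 * 0 ^ nat (- d)) (at 0)"
    by (intro tendsto_intros isCont_vector_scale cpoly_continuous homog_cpoly[OF f])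
  moreover have "\<forall>\<^sub>F t in at 0. f (t *s z) * t ^ nat (- d) = f z"
  proof (rule eventually_at_filter[THEN iffD2], rule always_eventually, intro allI impI)
    fix t :: complex assume t: "t \<noteq> 0"
    have "f (t *s z) * t ^ nat (- d) = t powi d * t powi (- d) * f z"
      using d by (simp add: homog_scale[OF f t] power_int_def)
    then show "f (t *s z) * t ^ nat (- d) = f z" using t by (simp add: power_int_minus)
  qed
  ultimately have "((\<lambda>t::complex. f z) \<longlongrightarrow> f 0 * 0 ^ nat (- d)) (at 0)"
    by (rule Lim_transform_eventually)
  then show "f z = 0 z" using d by (simp add: tendsto_const_iff)
qed

text \<open>After more than \<open>d\<close> derivatives the degree is negative. This is why the
  star product terminates on polynomials.\<close>

lemma pds_homog_eq_0: "f \<in> homog (int d) \<Longrightarrow> length as > d \<Longrightarrow> pds as f = 0"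
  using homog_pds homog_negative by fastforce

lemma homog_imp_H0: "f \<in> homog (int k) \<Longrightarrow> f \<in> H0 k"
  by (simp add: H0_def sections_def homog_cpoly cpoly_holomorphic cpoly_continuous homog_scale)

section \<open>Continuous global sections are homogeneous polynomials\<close>

definition upd :: "complex ^ 'n \<Rightarrow> 'n \<Rightarrow> complex \<Rightarrow> complex ^ 'n" where
  "upd z a t = (\<chi> i. if i = a then t else z $ i)"

lemma upd_nth: "upd z a t $ i = (if i = a then t else z $ i)"
  by (simp add: upd_def)

lemma upd_same: "upd z a (z $ a) = z"
  by (simp add: vec_eq_iff upd_nth)

text \<open>The nodes are the integers from 0 to \<open>k\<close>, the same for every slice, so that
  the interpolation coefficients are values of \<open>f\<close> on fixed hyperplanes.\<close>

definition lagrange_basis :: "nat \<Rightarrow> nat \<Rightarrow> complex poly" where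
  "lagrange_basis k j =
     (\<Prod>i\<in>{..k} - {j}. smult (1 / (of_nat j - of_nat i)) [:- of_nat i, 1:])"

lemma poly_lagrange_basis:
  assumes "i \<le> k" "j \<le> k"
  shows "poly (lagrange_basis k j) (of_nat i) = (if i = j then 1 else 0)"
proof -
  have "poly (lagrange_basis k j) (of_nat i) =
      (\<Prod>m\<in>{..k} - {j}. (of_nat i - of_nat m) / (of_nat j - of_nat m))"
    unfolding lagrange_basis_def poly_prod by (intro prod.cong) (simp_all add: diff_divide_distrib)
  also have "\<dots> = (if i = j then 1 else 0)"
    using assms by (auto intro!: prod.neutral prod_zero)
  finally show ?thesis .
qed

lemma degree_lagrange_basis:
  assumes "j \<le> k" shows "degree (lagrange_basis k j) \<le> k"
proof -
  have "degree (lagrange_basis k j) \<le>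
      (\<Sum>i\<in>{..k} - {j}. degree (smult (1 / (of_nat j - of_nat i)) [:- of_nat i, 1::complex:]))"
    unfolding lagrange_basis_def by (rule order.trans[OF degree_prod_sum_le]) (simp_all add: o_def)
  also have "\<dots> \<le> (\<Sum>i\<in>{..k} - {j}. 1)"
    by (intro sum_mono order.trans[OF degree_smult_le]) simp
  finally show ?thesis using assms by simp
qed

lemma lagrange_interpolation:
  assumes "degree p \<le> k"
  shows "p = (\<Sum>j\<le>k. smult (poly p (of_nat j)) (lagrange_basis k j))"
proof (rule poly_eqI_degree[where A = "of_nat ` {..k}"])
  fix x :: complex assume "x \<in> of_nat ` {..k}"
  then obtain i where i: "i \<le> k" "x = of_nat i" by auto
  show "poly p x = poly (\<Sum>j\<le>k. smult (poly p (of_nat j)) (lagrange_basis k j)) x"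
    using i by (simp add: poly_sum poly_lagrange_basis if_distrib cong: if_cong)
next
  have c: "card (of_nat ` {..k} :: complex set) = Suc k"
    by (subst card_image) (auto simp: inj_on_def)
  show "degree p < card (of_nat ` {..k} :: complex set)"
    using c assms by simp
  have "degree (\<Sum>j\<le>k. smult (poly p (of_nat j)) (lagrange_basis k j)) \<le> k"
    by (intro degree_sum_le) (auto intro: degree_lagrange_basis)
  then show "degree (\<Sum>j\<le>k. smult (poly p (of_nat j)) (lagrange_basis k j)) <
      card (of_nat ` {..k} :: complex set)"
    using c by simp
qed

text \<open>The degree bound \<open>k\<close> is uniform in the point and the variable, so the same
  \<open>k + 1\<close> nodes interpolate all slices. Each interpolation trades the dependence on one
  variable for explicit polynomials in it.\<close>

lemma separately_polynomial_imp_cpoly: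
  fixes f :: "complex ^ 'n::finite \<Rightarrow> complex"
  assumes sep: "\<And>z a. \<exists>p. degree p \<le> k \<and> (\<forall>t. f (upd z a t) = poly p t)"
  shows "f \<in> cpoly"
proof -
  \<comment> \<open>Induction over a set \<open>S\<close> of variables that determine the value of
    \<open>f\<close>. Freezing the coordinate \<open>a\<close> at a node leaves a function
    determined by the remaining variables.\<close>
  have restricted: "f \<in> cpoly" if "finite S"
    "\<And>z a. \<exists>p. degree p \<le> k \<and> (\<forall>t. f (upd z a t) = poly p t)"
    "\<And>z w. (\<forall>i\<in>S. z $ i = w $ i) \<Longrightarrow> f z = f w" for S and f :: "complex ^ 'n \<Rightarrow> complex"
    using that
  proof (induction S arbitrary: f rule: finite_induct)
    case empty
    then obtain c where "f = (\<lambda>z. c)" by blast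
    then show ?case by (simp add: cpoly.const)
  next
    case (insert a S)
    have interpol: "f z = (\<Sum>j\<le>k. f (upd z a (of_nat j)) * poly (lagrange_basis k j) (z $ a))" for z
    proof -
      obtain p where p: "degree p \<le> k" "\<And>t. f (upd z a t) = poly p t"
        using insert.prems(1) by blast
      have "f z = poly p (z $ a)"
        using p(2)[of "z $ a"] by (simp add: upd_same)
      also have "\<dots> = (\<Sum>j\<le>k. poly p (of_nat j) * poly (lagrange_basis k j) (z $ a))"
        by (subst lagrange_interpolation[OF p(1)]) (simp add: poly_sum)
      finally show ?thesis by (simp add: p(2))
    qed
    have eq: "(\<Sum>j\<le>k. (\<lambda>z. f (upd z a (of_nat j))) * (\<lambda>z. poly (lagrange_basis k j) (z $ a))) = f"
      by (rule ext, simp only: sum_fun_apply times_fun_apply, rule interpol[symmetric])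
    have slice: "(\<lambda>z. f (upd z a (of_nat j))) \<in> cpoly" for j
    proof (rule insert.IH)
      fix z b
      show "\<exists>p. degree p \<le> k \<and> (\<forall>t. f (upd (upd z b t) a (of_nat j)) = poly p t)"
      proof (cases "b = a")
        case True
        have "upd (upd z b t) a (of_nat j) = upd z a (of_nat j)" for t
          using True by (simp add: vec_eq_iff upd_nth)
        then show ?thesis by (intro exI[of _ "[:f (upd z a (of_nat j)):]"]) simp
      next
        case False
        have "upd (upd z b t) a (of_nat j) = upd (upd z a (of_nat j)) b t" for t
          using False by (simp add: vec_eq_iff upd_nth)
        then show ?thesis using insert.prems(1) by simp
      qed
    next
      fix z w :: "complex ^ 'n"
      assume "\<forall>i\<in>S. z $ i = w $ i"
      then show "f (upd z a (of_nat j)) = f (upd w a (of_nat j))"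
        by (intro insert.prems(2)) (simp add: upd_nth)
    qed
    have "(\<Sum>j\<le>k. (\<lambda>z. f (upd z a (of_nat j))) * (\<lambda>z. poly (lagrange_basis k j) (z $ a))) \<in> cpoly"
      by (intro cpoly_sum cpoly_mult cpoly_poly_coord slice)
    then show ?case by (simp only: eq)
  qed
  show ?thesis
  proof (rule restricted[OF finite[of UNIV] sep])
    fix z w :: "complex ^ 'n"
    assume "\<forall>i\<in>UNIV. z $ i = w $ i"
    then have "z = w" by (simp add: vec_eq_iff)
    then show "f z = f w" by (rule arg_cong)
  qed
qed

lemma H0_continuous:
  assumes f: "f \<in> H0 k"
  shows "isCont f z"
proof (cases "z = 0")
  case False
  then obtain c where "(f has_derivative (\<lambda>h. \<Sum>a\<in>UNIV. c a * h $ a)) (at z)"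
    using f by (fastforce simp: H0_def sections_def holomorphic_sev_def)
  then show ?thesis by (rule has_derivative_continuous)
qed (use f in \<open>simp add: H0_def\<close>)

text \<open>At the origin homogeneity is not part of \<open>sections\<close>. There both sides are
  limits of their values at nonzero points, where it holds by definition.\<close>

lemma H0_scale:
  fixes f :: "complex ^ 'n::finite \<Rightarrow> complex"
  assumes f: "f \<in> H0 k" and t: "t \<noteq> 0"
  shows "f (t *s z) = t ^ k * f z"
proof -
  have nz: "f (t *s z) = t ^ k * f z" if "z \<noteq> 0" for z
    using f t that by (simp add: H0_def sections_def)
  show ?thesis
  proof (cases "z = 0")
    case True
    have lim: "(f \<longlongrightarrow> f 0) (at 0)" using f by (simp add: H0_def isCont_def)
    have "((\<lambda>z. t *s z) \<longlongrightarrow> 0) (at 0)"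
      by (rule vec_tendstoI) (auto intro!: tendsto_eq_intros)
    then have "((\<lambda>z. f (t *s z)) \<longlongrightarrow> f 0) (at 0)"
      using f by (intro isCont_tendsto_compose[of 0 f]) (simp_all add: H0_def)
    moreover have "((\<lambda>z. t ^ k * f z) \<longlongrightarrow> t ^ k * f 0) (at 0)"
      by (rule tendsto_mult_left[OF lim])
    then have "((\<lambda>z. f (t *s z)) \<longlongrightarrow> t ^ k * f 0) (at 0)"
      by (rule Lim_transform_eventually) (simp add: eventually_at_filter nz)
    ultimately have "f 0 = t ^ k * f 0"
      by (rule tendsto_unique[OF at_neq_bot])
    then show ?thesis by (simp only: True vector_smult_rzero)
  qed (rule nz)
qed

lemma norm_axis: "norm (axis a x :: complex ^ 'n::finite) = norm x"
  by (simp add: norm_eq_sqrt_inner inner_axis_axis)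

text \<open>A continuous function is bounded on the compact unit sphere, and homogeneity carries the
  bound to all nonzero points.\<close>

lemma H0_growth:
  fixes f :: "complex ^ 'n::finite \<Rightarrow> complex"
  assumes f: "f \<in> H0 k"
  shows "\<exists>M\<ge>0. \<forall>z. z \<noteq> 0 \<longrightarrow> norm (f z) \<le> M * norm z ^ k"
proof -
  have "compact (f ` sphere 0 1)"
    by (intro compact_continuous_image compact_sphere continuous_at_imp_continuous_on ballI
        H0_continuous[OF f])
  then obtain M where M: "\<And>u. norm u = 1 \<Longrightarrow> norm (f u) \<le> M"
    using compact_imp_bounded by (force simp: bounded_iff)
  \<comment> \<open>Any unit vector will do here: the bound at it forces \<open>M\<close> to be
    nonnegative.\<close>
  have M0: "M \<ge> 0"
    using order.trans[OF norm_ge_zero M[of "axis undefined 1"]] by (simp add: norm_axis)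
  moreover have "norm (f z) \<le> M * norm z ^ k" if "z \<noteq> 0" for z
  proof -
    define u where "u = (1 / norm z) *\<^sub>R z"
    have u: "norm u = 1" using that by (simp add: u_def)
    have "z = complex_of_real (norm z) *s u"
      using that by (simp add: vec_eq_iff u_def scaleR_conv_of_real[where 'a = complex])
    then have "f z = complex_of_real (norm z) ^ k * f u"
      using H0_scale[OF f, of "complex_of_real (norm z)" u] that by simp
    then have "norm (f z) = norm z ^ k * norm (f u)" by (simp add: norm_mult norm_power)
    also have "\<dots> \<le> norm z ^ k * M" using M[OF u] by (intro mult_left_mono) auto
    finally show ?thesis by (simp add: mult.commute)
  qed
  ultimately show ?thesis by blast
qed

lemma upd_eq_axis: "upd z a t = upd z a 0 + axis a t"
  by (simp add: vec_eq_iff upd_nth axis_def)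

lemma bounded_linear_axis: "bounded_linear (axis a :: complex \<Rightarrow> complex ^ 'n::finite)"
proof (rule bounded_linear_intro[where K = 1])
  show "axis a (x + y) = axis a x + (axis a y :: complex ^ 'n)" for x y
    by (simp add: vec_eq_iff axis_def)
  show "axis a (r *\<^sub>R x) = r *\<^sub>R (axis a x :: complex ^ 'n)" for r x
    by (simp add: vec_eq_iff axis_def)
qed (simp add: norm_axis)

text \<open>Along a coordinate line \<open>f\<close> is an entire function of growth at most
  \<open>norm t ^ k\<close>, hence a polynomial of degree at most \<open>k\<close> by Liouville's
  theorem.\<close>

lemma H0_slice_polynomial:
  fixes f :: "complex ^ 'n::finite \<Rightarrow> complex"
  assumes f: "f \<in> H0 k"
  shows "\<exists>p. degree p \<le> k \<and> (\<forall>t. f (upd z a t) = poly p t)"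
proof -
  define g where "g t = f (upd z a t)" for t
  have deriv_upd: "(upd z a has_derivative axis a) (at t)" for t
  proof -
    have "((\<lambda>t. upd z a 0 + axis a t) has_derivative (\<lambda>h. 0 + axis a h)) (at t)"
      by (rule has_derivative_add[OF has_derivative_const
          bounded_linear_imp_has_derivative[OF bounded_linear_axis]])
    moreover have "(\<lambda>t. upd z a 0 + axis a t) = upd z a"
      by (rule ext) (rule upd_eq_axis[symmetric])
    ultimately show ?thesis by simp
  qed
  have "g field_differentiable at t" if "t \<noteq> 0" for t
  proof -
    \<comment> \<open>The coordinate \<open>a\<close> of this point is \<open>t\<close>, so the line
      can meet the origin only at parameter 0.\<close>
    have "upd z a t \<noteq> 0" using that by (auto simp: vec_eq_iff upd_nth)
    then obtain c where c: "(f has_derivative (\<lambda>h. \<Sum>b\<in>UNIV. c b * h $ b)) (at (upd z a t))"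
      using f by (fastforce simp: H0_def sections_def holomorphic_sev_def)
    have "((\<lambda>t. f (upd z a t)) has_derivative (\<lambda>h. \<Sum>b\<in>UNIV. c b * axis a h $ b)) (at t)"
      using has_derivative_compose[OF deriv_upd c] .
    moreover have "(\<Sum>b\<in>UNIV. c b * axis a h $ b) = c a * h" for h
      by (simp add: axis_def if_distrib[of "\<lambda>x. _ * x"] cong: if_cong)
    ultimately have "(g has_derivative (\<lambda>h. c a * h)) (at t)" by (simp add: g_def [abs_def])
    then show ?thesis
      by (auto simp: field_differentiable_def has_field_derivative_def mult_commute_abs)
  qed
  then have punctured: "g holomorphic_on UNIV - {0}"
    by (auto simp: holomorphic_on_def field_differentiable_at_within)
  have cont: "continuous_on UNIV g"
  proof (intro continuous_at_imp_continuous_on ballI)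
    fix t
    have "isCont (upd z a) t" using deriv_upd by (rule has_derivative_continuous)
    then show "isCont g t" unfolding g_def by (rule isCont_o2) (rule H0_continuous[OF f])
  qed
  \<comment> \<open>Continuity makes the singularity at parameter 0 removable.\<close>
  have hol: "g holomorphic_on UNIV"
    by (rule no_isolated_singularity[OF cont punctured]) simp_all
  obtain M where M: "M \<ge> 0" "\<And>z. z \<noteq> 0 \<Longrightarrow> norm (f z) \<le> M * norm z ^ k"
    using H0_growth[OF f] by blast
  \<comment> \<open>For \<open>1 \<le> norm t\<close> the triangle inequality gives \<open>norm (upd
    z a t) \<le> norm (upd z a 0) + norm t \<le> C * norm t\<close>.\<close>
  define C where "C = norm (upd z a 0) + 1"
  have "norm (g t) \<le> M * C ^ k * norm t ^ k" if "1 \<le> norm t" for t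
  proof -
    have "t \<noteq> 0" using that by auto
    then have "upd z a t \<noteq> 0" by (auto simp: vec_eq_iff upd_nth)
    then have "norm (g t) \<le> M * norm (upd z a t) ^ k" unfolding g_def by (rule M)
    also have "\<dots> \<le> M * (C * norm t) ^ k"
    proof (intro mult_left_mono power_mono M(1) norm_ge_zero)
      have "norm (upd z a t) \<le> norm (upd z a 0) + norm t"
        using norm_triangle_ineq[of "upd z a 0" "axis a t"]
        by (simp only: upd_eq_axis[of z a t] norm_axis)
      also have "\<dots> \<le> C * norm t"
        using that mult_left_mono[OF that, of "norm (upd z a 0)"] by (simp add: C_def algebra_simps)
      finally show "norm (upd z a t) \<le> C * norm t" .
    qed
    finally have "norm (g t) \<le> M * (C * norm t) ^ k" .
    then show ?thesis by (simp add: power_mult_distrib mult.assoc)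
  qed
  from Liouville_polynomial[OF hol this]
  have g: "g t = (\<Sum>i\<le>k. (deriv ^^ i) g 0 / fact i * t ^ i)" for t by blast
  define p where "p = (\<Sum>i\<le>k. monom ((deriv ^^ i) g 0 / fact i) i)"
  have "degree p \<le> k" unfolding p_def
    by (intro degree_sum_le) (auto intro: order.trans[OF degree_monom_le])
  moreover have "f (upd z a t) = poly p t" for t
    using g[of t] by (simp add: p_def g_def[symmetric] poly_sum poly_monom)
  ultimately show ?thesis by blast
qed

lemma H0_eq_homog: "H0 k = homog (int k)"
proof
  show "H0 k \<subseteq> homog (int k)"
  proof
    fix f :: "complex ^ 'n \<Rightarrow> complex"
    assume f: "f \<in> H0 k"
    show "f \<in> homog (int k)"
    proof (rule homogI)
      show "f \<in> cpoly" using H0_slice_polynomial[OF f] by (rule separately_polynomial_imp_cpoly)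
    qed (simp add: H0_scale[OF f])
  qed
qed (auto intro: homog_imp_H0)

text \<open>Constants and coordinates are homogeneous, of degrees 0 and 1. Sums are formed degree by
  degree, and a product of components of degrees \<open>k\<close> and \<open>l\<close> is
  homogeneous of degree \<open>k + l\<close>.\<close>

lemma sum_H0_eq_cpoly: "sum_H0 = cpoly"
proof
  show "(sum_H0 :: (complex ^ 'n \<Rightarrow> complex) set) \<subseteq> cpoly"
  proof
    fix f :: "complex ^ 'n \<Rightarrow> complex"
    assume "f \<in> sum_H0"
    then obtain N h where "\<forall>k\<le>N. h k \<in> H0 k" and "f = (\<lambda>z. \<Sum>k\<le>N. h k z)"
      by (auto simp: sum_H0_def)
    then have "f = (\<Sum>k\<le>N. h k)" "\<forall>k\<le>N. h k \<in> cpoly"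
      by (auto simp: sum_fun_apply fun_eq_iff H0_eq_homog homog_cpoly)
    then show "f \<in> cpoly" by (auto intro: cpoly_sum)
  qed
  have sumI: "(\<Sum>k\<le>N. h k) \<in> sum_H0" if "\<And>k. h k \<in> H0 k" for N and h :: "nat \<Rightarrow> complex ^ 'n \<Rightarrow> complex"
    using that unfolding sum_H0_def by (auto simp: fun_eq_iff sum_fun_apply)
  \<comment> \<open>Padding with zero components makes a decomposition valid at every larger length,
    so that two of them can be brought to a common length.\<close>
  have sumE: "\<exists>h N. (\<forall>k. h k \<in> H0 k) \<and> (\<forall>N'\<ge>N. f = (\<Sum>k\<le>N'. h k))" if "f \<in> sum_H0" for f :: "complex ^ 'n \<Rightarrow> complex"
  proof -
    from that obtain N h where h: "\<forall>k\<le>N. h k \<in> H0 k" "f = (\<lambda>z. \<Sum>k\<le>N. h k z)"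
      by (auto simp: sum_H0_def)
    define h' where "h' k = (if k \<le> N then h k else 0)" for k
    have "f = (\<Sum>k\<le>N'. h' k)" if "N' \<ge> N" for N'
    proof -
      have "(\<Sum>k\<le>N'. h' k) = (\<Sum>k\<le>N. h' k)"
        using that by (intro sum.mono_neutral_right) (auto simp: h'_def)
      then show ?thesis by (simp add: h(2) h'_def fun_eq_iff sum_fun_apply)
    qed
    moreover have "h' k \<in> H0 k" for k using h(1) by (simp add: h'_def H0_eq_homog homog_0)
    ultimately show ?thesis by blast
  qed
  have single: "f \<in> sum_H0" if "f \<in> H0 k" for k and f :: "complex ^ 'n \<Rightarrow> complex"
  proof -
    have "(\<Sum>i\<le>k. if i = k then f else 0) \<in> sum_H0"
      by (rule sumI) (use that in \<open>auto simp: H0_eq_homog homog_0\<close>)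
    then show ?thesis by simp
  qed
  have closed_add: "f + g \<in> sum_H0" if fg: "f \<in> sum_H0" "g \<in> sum_H0" for f g :: "complex ^ 'n \<Rightarrow> complex"
  proof -
    obtain h M where h: "\<forall>k. h k \<in> H0 k" "\<forall>N\<ge>M. f = (\<Sum>k\<le>N. h k)" using sumE[OF fg(1)] by blast
    obtain h' M' where h': "\<forall>k. h' k \<in> H0 k" "\<forall>N\<ge>M'. g = (\<Sum>k\<le>N. h' k)" using sumE[OF fg(2)] by blast
    have "f + g = (\<Sum>k\<le>max M M'. h k + h' k)"
      using h(2)[rule_format, of "max M M'"] h'(2)[rule_format, of "max M M'"] by (simp add: sum.distrib)
    moreover have "h k + h' k \<in> H0 k" for k
      using h(1) h'(1) by (simp add: H0_eq_homog homog_add)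
    ultimately show ?thesis using sumI[of "\<lambda>k. h k + h' k"] by simp
  qed
  have zero: "0 \<in> (sum_H0 :: (complex ^ 'n \<Rightarrow> complex) set)"
    by (rule single[of _ 0]) (simp add: H0_eq_homog homog_0)
  have sum: "(\<Sum>i\<in>A. F i) \<in> sum_H0" if "\<And>i. i \<in> A \<Longrightarrow> F i \<in> sum_H0"
    for A :: "nat set" and F :: "nat \<Rightarrow> complex ^ 'n \<Rightarrow> complex"
    using that by (induction A rule: infinite_finite_induct) (auto intro: zero closed_add)
  show "cpoly \<subseteq> (sum_H0 :: (complex ^ 'n \<Rightarrow> complex) set)"
  proof
    fix f :: "complex ^ 'n \<Rightarrow> complex"
    assume "f \<in> cpoly"
    then show "f \<in> sum_H0"
    proof (induction rule: cpoly_induct)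
      case (const c)
      show ?case by (rule single[of _ 0]) (simp add: H0_eq_homog homog_const)
    next
      case (coord a)
      show ?case by (rule single[of _ 1]) (simp add: H0_eq_homog homog_coord)
    next
      case (add f g)
      show ?case by (rule closed_add) fact+
    next
      case (mult f g)
      obtain h M where h: "\<forall>k. h k \<in> H0 k" "\<forall>N\<ge>M. f = (\<Sum>k\<le>N. h k)" using sumE[OF mult.IH(1)] by blast
      obtain h' M' where h': "\<forall>k. h' k \<in> H0 k" "\<forall>N\<ge>M'. g = (\<Sum>k\<le>N. h' k)" using sumE[OF mult.IH(2)] by blast
      have "f * g = (\<Sum>k\<le>M. \<Sum>l\<le>M'. h k * h' l)"
        using h(2)[rule_format, of M] h'(2)[rule_format, of M']
        by (simp add: sum_product)
      moreover have "h k * h' l \<in> sum_H0" for k l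
        by (rule single[of _ "k + l"]) (use h(1) h'(1) in \<open>simp add: H0_eq_homog homog_mult\<close>)
      ultimately show ?case by (simp add: sum)
    qed
  qed
qed

section \<open>Bidifferential operators with Casimir coefficients\<close>

text \<open>
  As simplification rules these would evaluate eta-expanded functions and so hide the ring
  structure.
\<close>

lemmas fun_apply_simps = plus_fun_apply times_fun_apply zero_fun_apply one_fun_apply
  uminus_apply of_nat_fun_apply
declare fun_apply_simps [simp del]

section \<open>Recursion and linearity of \<open>normal_op\<close>\<close>

lemma sum_lists_Suc:
  fixes F :: "'n::finite list \<Rightarrow> 'b::comm_monoid_add"
  shows "(\<Sum>as | length as = Suc k. F as) = (\<Sum>a\<in>UNIV. \<Sum>as | length as = k. F (a # as))"
proof -
  have "(\<Sum>as | length as = Suc k. F as) = (\<Sum>(a, as)\<in>UNIV \<times> {as. length as = k}. F (a # as))"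
    by (rule sum.reindex_bij_witness[of _ "\<lambda>(a, as). a # as" "\<lambda>as. (hd as, tl as)"])
      (auto simp: length_Suc_conv)
  also have "\<dots> = (\<Sum>a\<in>UNIV. \<Sum>as | length as = k. F (a # as))"
    by (rule sum.cartesian_product[symmetric])
  finally show ?thesis .
qed

lemma normal_op_0: "normal_op L 0 f g = f * g"
  by (simp add: normal_op_def fun_eq_iff fun_apply_simps)

text \<open>The recursion behind most later inductions. As all coefficients stand outside the
  derivatives, splitting off the first index pair only requires that partial derivatives
  commute.\<close>

lemma normal_op_Suc:
  assumes "f \<in> cpoly" "g \<in> cpoly"
  shows "normal_op L (Suc k) f g = (\<Sum>a\<in>UNIV. \<Sum>b\<in>UNIV. L a b * normal_op L k (pd a f) (pd b g))"
proof
  fix z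
  have "normal_op L (Suc k) f g z = (\<Sum>a\<in>UNIV. \<Sum>as | length as = k. \<Sum>b\<in>UNIV. \<Sum>bs | length bs = k.
      L a b z * ((\<Prod>i<k. L (as ! i) (bs ! i) z) * pds as (pd a f) z * pds bs (pd b g) z))"
    unfolding normal_op_def sum_lists_Suc
    by (simp add: prod.lessThan_Suc_shift pds_pd assms mult_ac del: prod.lessThan_Suc)
  also have "\<dots> = (\<Sum>a\<in>UNIV. \<Sum>b\<in>UNIV. L a b z * normal_op L k (pd a f) (pd b g) z)"
    unfolding normal_op_def sum_distrib_left by (intro sum.cong refl) (rule sum.swap)
  finally show "normal_op L (Suc k) f g z =
      (\<Sum>a\<in>UNIV. \<Sum>b\<in>UNIV. L a b * normal_op L k (pd a f) (pd b g)) z"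
    by (simp add: sum_fun_apply fun_apply_simps)
qed

lemma normal_op_zero: "normal_op L k 0 g = 0" "normal_op L k f 0 = 0"
proof -
  have "pds as 0 = 0" for as :: "'a list"
    by (induction as) simp_all
  then show "normal_op L k 0 g = 0" "normal_op L k f 0 = 0"
    by (simp_all add: normal_op_def fun_eq_iff fun_apply_simps)
qed

lemma normal_op_add_left:
  assumes "f \<in> cpoly" "g \<in> cpoly" "h \<in> cpoly"
  shows "normal_op L k (f + g) h = normal_op L k f h + normal_op L k g h"
proof -
  have "pds as (f + g) = pds as f + pds as g" for as
    using assms by (induction as) (simp_all add: pd_add pds_cpoly)
  then show ?thesis by (simp add: normal_op_def fun_eq_iff fun_apply_simps algebra_simps sum.distrib)
qed

lemma normal_op_add_right:
  assumes "f \<in> cpoly" "g \<in> cpoly" "h \<in> cpoly"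
  shows "normal_op L k h (f + g) = normal_op L k h f + normal_op L k h g"
proof -
  have "pds as (f + g) = pds as f + pds as g" for as
    using assms by (induction as) (simp_all add: pd_add pds_cpoly)
  then show ?thesis by (simp add: normal_op_def fun_eq_iff fun_apply_simps algebra_simps sum.distrib)
qed

lemma normal_op_sum_left:
  "(\<And>i. i \<in> A \<Longrightarrow> F i \<in> cpoly) \<Longrightarrow> h \<in> cpoly \<Longrightarrow>
    normal_op L k (\<Sum>i\<in>A. F i) h = (\<Sum>i\<in>A. normal_op L k (F i) h)"
  by (induction A rule: infinite_finite_induct)
    (simp_all add: normal_op_zero normal_op_add_left cpoly_sum)

lemma normal_op_sum_right:
  "(\<And>i. i \<in> A \<Longrightarrow> F i \<in> cpoly) \<Longrightarrow> h \<in> cpoly \<Longrightarrow>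
    normal_op L k h (\<Sum>i\<in>A. F i) = (\<Sum>i\<in>A. normal_op L k h (F i))"
  by (induction A rule: infinite_finite_induct)
    (simp_all add: normal_op_zero normal_op_add_right cpoly_sum)

text \<open>Pascal's rule in the form needed for nested operators: raising the total order by one
  raises either the outer order \<open>m\<close> or the inner order.\<close>

lemma sum_pascal:
  fixes U :: "nat \<Rightarrow> nat \<Rightarrow> 'b::comm_semiring_1"
  shows "(\<Sum>m\<le>Suc r. of_nat (Suc r choose m) * U m (Suc r - m)) =
    (\<Sum>m\<le>r. of_nat (r choose m) * (U (Suc m) (r - m) + U m (Suc (r - m))))"
proof -
  have "(\<Sum>m\<le>Suc r. of_nat (Suc r choose m) * U m (Suc r - m)) =
      U 0 (Suc r) + (\<Sum>m\<le>r. of_nat (r choose m) * U (Suc m) (r - m))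
      + (\<Sum>m\<le>r. of_nat (r choose Suc m) * U (Suc m) (r - m))"
    by (subst sum.atMost_Suc_shift) (simp add: algebra_simps sum.distrib)
  also have "U 0 (Suc r) + (\<Sum>m\<le>r. of_nat (r choose m) * U (Suc m) (r - m))
      + (\<Sum>m\<le>r. of_nat (r choose Suc m) * U (Suc m) (r - m)) =
      (\<Sum>m\<le>r. of_nat (r choose m) * U (Suc m) (r - m)) +
      (\<Sum>m\<le>Suc r. of_nat (r choose m) * U m (Suc r - m))"
    by (subst sum.atMost_Suc_shift) (simp add: ac_simps)
  also have "(\<Sum>m\<le>Suc r. of_nat (r choose m) * U m (Suc r - m)) =
      (\<Sum>m\<le>r. of_nat (r choose m) * U m (Suc (r - m)))"
    by (simp add: Suc_diff_le binomial_eq_0)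
  finally show ?thesis by (simp only: distrib_left sum.distrib)
qed

text \<open>Separates the algebra of the product from the derivation of the Casimir property. The
  assumptions are stable under transposing \<open>L\<close>, so statements about the right argument
  can be obtained from those about the left one.\<close>

locale casimir_coefficients =
  fixes L :: "'n::finite \<Rightarrow> 'n \<Rightarrow> complex ^ 'n \<Rightarrow> complex"
  assumes coeff_cpoly: "L a b \<in> cpoly"
    and skew: "L a b = - L b a"
    and coeff_casimir: "(\<Sum>a\<in>UNIV. L a b * pd a (L c d)) = 0"
begin

section \<open>Casimir functions behave as scalars\<close>

definition ham :: "'n \<Rightarrow> (complex ^ 'n \<Rightarrow> complex) \<Rightarrow> complex ^ 'n \<Rightarrow> complex" where
  "ham b f = (\<Sum>a\<in>UNIV. L a b * pd a f)"

text \<open>\<open>ham b f\<close> is the bracket of \<open>f\<close> with the coordinate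
  \<open>b\<close>. The bracket is a derivation, so vanishing against all coordinates means
  vanishing against all polynomials: these are the polynomial Casimir functions.\<close>

definition casimirs :: "(complex ^ 'n \<Rightarrow> complex) set" where
  "casimirs = {l \<in> cpoly. \<forall>b. ham b l = 0}"

lemma coeff_casimirs: "L c d \<in> casimirs"
  by (simp add: casimirs_def ham_def coeff_casimir coeff_cpoly)

lemma const_casimirs: "(\<lambda>_. c) \<in> casimirs"
  by (simp add: casimirs_def ham_def pd_const cpoly.const)

lemma casimirs_cpoly: "l \<in> casimirs \<Longrightarrow> l \<in> cpoly"
  by (simp add: casimirs_def)

lemma ham_cpoly: "f \<in> cpoly \<Longrightarrow> ham b f \<in> cpoly"
  unfolding ham_def by (intro cpoly_sum cpoly_mult coeff_cpoly pd_cpoly)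

lemma ham_mult: "f \<in> cpoly \<Longrightarrow> g \<in> cpoly \<Longrightarrow> ham b (f * g) = ham b f * g + f * ham b g"
  by (simp add: ham_def pd_mult algebra_simps sum.distrib sum_distrib_left)

lemma ham_sum: "(\<And>i. i \<in> A \<Longrightarrow> F i \<in> cpoly) \<Longrightarrow> ham b (\<Sum>i\<in>A. F i) = (\<Sum>i\<in>A. ham b (F i))"
  unfolding ham_def by (subst sum.swap) (simp add: pd_sum sum_distrib_left)

lemma ham_casimir_mult: "l \<in> casimirs \<Longrightarrow> f \<in> cpoly \<Longrightarrow> ham b (l * f) = l * ham b f"
  by (simp add: ham_mult casimirs_def)

lemma normal_op_cpoly: "f \<in> cpoly \<Longrightarrow> g \<in> cpoly \<Longrightarrow> normal_op L k f g \<in> cpoly"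
  by (induction k arbitrary: f g)
    (auto simp: normal_op_0 normal_op_Suc pd_cpoly coeff_cpoly intro!: cpoly_mult cpoly_sum)

text \<open>The first assumption is the induction hypothesis of the next lemma, which this one feeds back into.\<close>

lemma normal_op_Suc_ham_aux:
  assumes "\<And>l f g. l \<in> casimirs \<Longrightarrow> f \<in> cpoly \<Longrightarrow> g \<in> cpoly \<Longrightarrow>
      normal_op L k (l * f) g = l * normal_op L k f g"
    and "f \<in> cpoly" "g \<in> cpoly"
  shows "normal_op L (Suc k) f g = (\<Sum>b\<in>UNIV. normal_op L k (ham b f) (pd b g))"
proof -
  have "normal_op L k (ham b f) (pd b g) = (\<Sum>a\<in>UNIV. L a b * normal_op L k (pd a f) (pd b g))" for b
    by (simp add: ham_def normal_op_sum_left cpoly_mult coeff_cpoly pd_cpoly coeff_casimirs assms)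
  then show ?thesis
    by (simp add: normal_op_Suc assms(2,3)) (rule sum.swap)
qed

text \<open>In the form with \<open>ham\<close>, the derivatives reach the left argument only
  through derivations that annihilate \<open>l\<close>, so \<open>l\<close> passes through
  unchanged. Rewriting one step in this form uses the statement for the lower order, applied to the
  coefficients themselves.\<close>

lemma normal_op_casimir_left:
  "l \<in> casimirs \<Longrightarrow> f \<in> cpoly \<Longrightarrow> g \<in> cpoly \<Longrightarrow> normal_op L k (l * f) g = l * normal_op L k f g"
proof (induction k arbitrary: l f g)
  case 0
  then show ?case by (simp add: normal_op_0 mult.assoc)
next
  case (Suc k)
  have "normal_op L (Suc k) (l * f) g = (\<Sum>b\<in>UNIV. normal_op L k (ham b (l * f)) (pd b g))"
    using Suc by (intro normal_op_Suc_ham_aux) (auto simp: cpoly_mult casimirs_cpoly)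
  also have "\<dots> = (\<Sum>b\<in>UNIV. l * normal_op L k (ham b f) (pd b g))"
    using Suc by (simp add: ham_casimir_mult ham_cpoly pd_cpoly)
  also have "\<dots> = l * normal_op L (Suc k) f g"
    using Suc by (simp add: normal_op_Suc_ham_aux sum_distrib_left)
  finally show ?case .
qed

lemmas normal_op_Suc_ham = normal_op_Suc_ham_aux[OF normal_op_casimir_left]

text \<open>This is the Leibniz rule: the derivation \<open>ham c\<close> annihilates the
  coefficients inside the operator and therefore falls on one of the two arguments.\<close>

lemma ham_normal_op:
  "f \<in> cpoly \<Longrightarrow> g \<in> cpoly \<Longrightarrow> ham c (normal_op L k f g) =
    (\<Sum>e\<in>UNIV. L e c * (normal_op L k (pd e f) g + normal_op L k f (pd e g)))"
proof (induction k arbitrary: f g)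
  case 0
  then show ?case
    by (simp add: normal_op_0 ham_mult) (simp add: ham_def algebra_simps sum.distrib sum_distrib_left)
next
  case (Suc k)
  have "ham c (normal_op L (Suc k) f g) =
      (\<Sum>a\<in>UNIV. \<Sum>b\<in>UNIV. L a b * ham c (normal_op L k (pd a f) (pd b g)))"
    using Suc.prems
    by (simp add: normal_op_Suc ham_sum ham_casimir_mult coeff_casimirs coeff_cpoly cpoly_sum
        cpoly_mult normal_op_cpoly pd_cpoly)
  also have "\<dots> = (\<Sum>a\<in>UNIV. \<Sum>b\<in>UNIV. \<Sum>e\<in>UNIV. L e c * (L a b *
      (normal_op L k (pd a (pd e f)) (pd b g) + normal_op L k (pd a f) (pd b (pd e g)))))"
    using Suc by (simp add: pd_cpoly sum_distrib_left mult.left_commute pd_commute)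
  also have "\<dots> = (\<Sum>a\<in>UNIV. \<Sum>e\<in>UNIV. \<Sum>b\<in>UNIV. L e c * (L a b *
      (normal_op L k (pd a (pd e f)) (pd b g) + normal_op L k (pd a f) (pd b (pd e g)))))"
    by (rule sum.cong[OF refl], rule sum.swap)
  also have "\<dots> = (\<Sum>e\<in>UNIV. \<Sum>a\<in>UNIV. \<Sum>b\<in>UNIV. L e c * (L a b *
      (normal_op L k (pd a (pd e f)) (pd b g) + normal_op L k (pd a f) (pd b (pd e g)))))"
    by (rule sum.swap)
  also have "\<dots> = (\<Sum>e\<in>UNIV. L e c * (normal_op L (Suc k) (pd e f) g + normal_op L (Suc k) f (pd e g)))"
    using Suc.prems by (simp add: normal_op_Suc pd_cpoly sum_distrib_left distrib_left sum.distrib)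
  finally show ?case .
qed

text \<open>Each of the \<open>k\<close> skew coefficients contributes one sign.\<close>

lemma normal_op_flip:
  "f \<in> cpoly \<Longrightarrow> g \<in> cpoly \<Longrightarrow> normal_op L k g f = (-1) ^ k * normal_op L k f g"
proof (induction k arbitrary: f g)
  case (Suc k)
  have "normal_op L (Suc k) g f = (\<Sum>a\<in>UNIV. \<Sum>b\<in>UNIV. L a b * normal_op L k (pd a g) (pd b f))"
    using Suc.prems by (simp add: normal_op_Suc)
  also have "\<dots> = (\<Sum>a\<in>UNIV. \<Sum>b\<in>UNIV. (-1) ^ Suc k * (L b a * normal_op L k (pd b f) (pd a g)))"
  proof (intro sum.cong refl)
    fix a b
    have "normal_op L k (pd a g) (pd b f) = (-1) ^ k * normal_op L k (pd b f) (pd a g)"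
      using Suc.IH[of "pd b f" "pd a g"] Suc.prems by (simp add: pd_cpoly)
    then show "L a b * normal_op L k (pd a g) (pd b f) =
        (-1) ^ Suc k * (L b a * normal_op L k (pd b f) (pd a g))"
      by (subst skew) (simp add: algebra_simps)
  qed
  also have "\<dots> = (\<Sum>b\<in>UNIV. \<Sum>a\<in>UNIV. (-1) ^ Suc k * (L b a * normal_op L k (pd b f) (pd a g)))"
    by (rule sum.swap)
  also have "\<dots> = (-1) ^ Suc k * normal_op L (Suc k) f g"
    using Suc.prems by (simp add: normal_op_Suc sum_distrib_left)
  finally show ?case .
qed (simp add: normal_op_0 mult.commute)

lemma normal_op_casimir_right:
  assumes "l \<in> casimirs" "f \<in> cpoly" "g \<in> cpoly"
  shows "normal_op L k f (l * g) = l * normal_op L k f g"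
  using assms normal_op_flip[of "l * g" f k] normal_op_flip[of g f k]
  by (simp add: casimirs_cpoly cpoly_mult normal_op_casimir_left mult.left_commute)

section \<open>Triple products and associativity order by order\<close>

fun tri_op :: "nat \<Rightarrow> (complex ^ 'n \<Rightarrow> complex) \<Rightarrow> (complex ^ 'n \<Rightarrow> complex) \<Rightarrow>
    (complex ^ 'n \<Rightarrow> complex) \<Rightarrow> complex ^ 'n \<Rightarrow> complex" where
  "tri_op 0 f g h = f * g * h"
| "tri_op (Suc r) f g h = (\<Sum>a\<in>UNIV. \<Sum>b\<in>UNIV. L a b *
     (tri_op r (pd a f) (pd b g) h + tri_op r (pd a f) g (pd b h) + tri_op r f (pd a g) (pd b h)))"

lemma nested_normal_op_Suc_inner:
  assumes "f \<in> cpoly" "g \<in> cpoly" "h \<in> cpoly"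
  shows "normal_op L m (normal_op L (Suc k) f g) h =
    (\<Sum>a\<in>UNIV. \<Sum>b\<in>UNIV. L a b * normal_op L m (normal_op L k (pd a f) (pd b g)) h)"
  using assms
  by (simp add: normal_op_Suc normal_op_sum_left normal_op_casimir_left coeff_casimirs coeff_cpoly
      cpoly_sum cpoly_mult normal_op_cpoly pd_cpoly)

text \<open>By \<open>ham_normal_op\<close> the new outer derivative falls on the first or the
  second factor of the inner product. This gives the summands
  \<open>\<Lambda>\<^sub>1\<^sub>3\<close> and \<open>\<Lambda>\<^sub>2\<^sub>3\<close>.\<close>

lemma nested_normal_op_Suc_outer:
  assumes "f \<in> cpoly" "g \<in> cpoly" "h \<in> cpoly"
  shows "normal_op L (Suc m) (normal_op L k f g) h =
    (\<Sum>a\<in>UNIV. \<Sum>b\<in>UNIV. L a b * (normal_op L m (normal_op L k (pd a f) g) (pd b h) +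
      normal_op L m (normal_op L k f (pd a g)) (pd b h)))"
proof -
  have "normal_op L (Suc m) (normal_op L k f g) h =
      (\<Sum>b\<in>UNIV. \<Sum>a\<in>UNIV. L a b * (normal_op L m (normal_op L k (pd a f) g) (pd b h) +
        normal_op L m (normal_op L k f (pd a g)) (pd b h)))"
    using assms
    by (simp add: normal_op_Suc_ham ham_normal_op normal_op_sum_left normal_op_casimir_left
        normal_op_add_left coeff_casimirs coeff_cpoly cpoly_add cpoly_mult normal_op_cpoly pd_cpoly)
  then show ?thesis by (subst sum.swap)
qed

text \<open>\<open>tri_op r\<close> is the power \<open>(\<Lambda>\<^sub>1\<^sub>2 +
  \<Lambda>\<^sub>1\<^sub>3 + \<Lambda>\<^sub>2\<^sub>3)\<^sup>r\<close>. The inner operator is a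
  power of \<open>\<Lambda>\<^sub>1\<^sub>2\<close>, the outer one a power of
  \<open>\<Lambda>\<^sub>1\<^sub>3 + \<Lambda>\<^sub>2\<^sub>3\<close>, so this is the binomial
  theorem, proved by Pascal's rule.\<close>

lemma sum_nested_left:
  assumes "f \<in> cpoly" "g \<in> cpoly" "h \<in> cpoly"
  shows "(\<Sum>m\<le>r. of_nat (r choose m) * normal_op L m (normal_op L (r - m) f g) h) = tri_op r f g h"
  using assms
proof (induction r arbitrary: f g h)
  case 0
  then show ?case by (simp add: normal_op_0)
next
  case (Suc r)
  define U where "U m k f g h = normal_op L m (normal_op L k f g) h" for m k f g h
  have IH: "(\<Sum>m\<le>r. of_nat (r choose m) * U m (r - m) f g h) = tri_op r f g h"
    if "f \<in> cpoly" "g \<in> cpoly" "h \<in> cpoly" for f g h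
    using Suc.IH[OF that] by (simp add: U_def)
  have "(\<Sum>m\<le>Suc r. of_nat (Suc r choose m) * U m (Suc r - m) f g h) =
      (\<Sum>m\<le>r. of_nat (r choose m) * (U (Suc m) (r - m) f g h + U m (Suc (r - m)) f g h))"
    by (rule sum_pascal)
  \<comment> \<open>Raising the inner order yields the first of the three summands, raising the
    outer order the other two.\<close>
  also have "\<dots> = (\<Sum>m\<le>r. \<Sum>a\<in>UNIV. \<Sum>b\<in>UNIV. L a b * (of_nat (r choose m) *
      (U m (r - m) (pd a f) (pd b g) h + U m (r - m) (pd a f) g (pd b h) + U m (r - m) f (pd a g) (pd b h))))"
    unfolding U_def nested_normal_op_Suc_inner[OF Suc.prems] nested_normal_op_Suc_outer[OF Suc.prems]
    by (simp add: sum_distrib_left sum.distrib algebra_simps)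
  also have "\<dots> = (\<Sum>a\<in>UNIV. \<Sum>m\<le>r. \<Sum>b\<in>UNIV. L a b * (of_nat (r choose m) *
      (U m (r - m) (pd a f) (pd b g) h + U m (r - m) (pd a f) g (pd b h) + U m (r - m) f (pd a g) (pd b h))))"
    by (rule sum.swap)
  also have "\<dots> = (\<Sum>a\<in>UNIV. \<Sum>b\<in>UNIV. \<Sum>m\<le>r. L a b * (of_nat (r choose m) *
      (U m (r - m) (pd a f) (pd b g) h + U m (r - m) (pd a f) g (pd b h) + U m (r - m) f (pd a g) (pd b h))))"
    by (intro sum.cong refl) (rule sum.swap)
  also have "\<dots> = tri_op (Suc r) f g h"
    using Suc.prems
    by (simp add: IH[symmetric] pd_cpoly sum_distrib_left distrib_left sum.distrib)
  finally show ?case by (simp add: U_def)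
qed

text \<open>Reversing the factors turns \<open>\<Lambda>\<^sub>1\<^sub>2\<close>,
  \<open>\<Lambda>\<^sub>1\<^sub>3\<close>, \<open>\<Lambda>\<^sub>2\<^sub>3\<close> into the
  negatives of \<open>\<Lambda>\<^sub>2\<^sub>3\<close>, \<open>\<Lambda>\<^sub>1\<^sub>3\<close>,
  \<open>\<Lambda>\<^sub>1\<^sub>2\<close>, so their sum changes sign.\<close>

lemma tri_op_flip: "tri_op r h g f = (-1) ^ r * tri_op r f g h"
proof (induction r arbitrary: f g h)
  case (Suc r)
  have "tri_op (Suc r) h g f = (\<Sum>a\<in>UNIV. \<Sum>b\<in>UNIV. (-1) ^ Suc r * (L b a *
      (tri_op r (pd b f) (pd a g) h + tri_op r (pd b f) g (pd a h) + tri_op r f (pd b g) (pd a h))))"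
    unfolding tri_op.simps
  proof (intro sum.cong refl)
    fix a b
    show "L a b * (tri_op r (pd a h) (pd b g) f + tri_op r (pd a h) g (pd b f) + tri_op r h (pd a g) (pd b f)) =
      (-1) ^ Suc r * (L b a *
      (tri_op r (pd b f) (pd a g) h + tri_op r (pd b f) g (pd a h) + tri_op r f (pd b g) (pd a h)))"
      by (subst skew, subst (1 2 3) Suc.IH) (simp add: algebra_simps)
  qed
  also have "\<dots> = (\<Sum>b\<in>UNIV. \<Sum>a\<in>UNIV. (-1) ^ Suc r * (L b a *
      (tri_op r (pd b f) (pd a g) h + tri_op r (pd b f) g (pd a h) + tri_op r f (pd b g) (pd a h))))"
    by (rule sum.swap)
  finally show ?case by (simp add: sum_distrib_left)
qed (simp add: mult_ac)

text \<open>Reversing both the outer and the inner operator reduces this bracketing to the other one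
  with the factors in opposite order. The signs multiply to \<open>(-1) ^ r\<close>, which
  \<open>tri_op_flip\<close> cancels.\<close>

lemma sum_nested_right:
  assumes "f \<in> cpoly" "g \<in> cpoly" "h \<in> cpoly"
  shows "(\<Sum>m\<le>r. of_nat (r choose m) * normal_op L m f (normal_op L (r - m) g h)) = tri_op r f g h"
proof -
  \<comment> \<open>The sign is a power in the ring of functions, so it must be recognized as a
    constant function before it can leave the argument.\<close>
  have sign: "(-1) ^ j \<in> casimirs" for j
  proof -
    have "((-1) ^ j :: complex ^ 'n \<Rightarrow> complex) = (\<lambda>_. (-1) ^ j)"
      by (induction j) (auto simp: fun_eq_iff fun_apply_simps)
    then show ?thesis by (simp add: const_casimirs)
  qed
  have "normal_op L m f (normal_op L (r - m) g h) =
      (-1) ^ r * normal_op L m (normal_op L (r - m) h g) f" if "m \<le> r" for m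
  proof -
    have "normal_op L m f (normal_op L (r - m) g h) =
        (-1) ^ m * normal_op L m (normal_op L (r - m) g h) f"
      by (intro normal_op_flip normal_op_cpoly assms)
    also have "\<dots> = (-1) ^ m * normal_op L m ((-1) ^ (r - m) * normal_op L (r - m) h g) f"
      by (subst normal_op_flip[of h g]) (simp_all add: assms)
    also have "\<dots> = (-1) ^ m * (-1) ^ (r - m) * normal_op L m (normal_op L (r - m) h g) f"
      using assms by (simp add: normal_op_casimir_left sign normal_op_cpoly mult.assoc)
    finally show ?thesis using that by (simp flip: power_add)
  qed
  then have "(\<Sum>m\<le>r. of_nat (r choose m) * normal_op L m f (normal_op L (r - m) g h)) =
      (-1) ^ r * (\<Sum>m\<le>r. of_nat (r choose m) * normal_op L m (normal_op L (r - m) h g) f)"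
    by (simp add: sum_distrib_left mult.left_commute)
  also have "\<dots> = (-1) ^ r * tri_op r h g f"
    by (simp only: sum_nested_left[OF assms(3,2,1)])
  also have "\<dots> = tri_op r f g h"
    by (subst tri_op_flip) (simp flip: mult.assoc power_mult_distrib)
  finally show ?thesis .
qed

lemma star_coeff_alt: "star_coeff L k f g = (\<lambda>_. 1 / fact k * (1 / 2) ^ k) * normal_op L k f g"
  by (simp add: star_coeff_def fun_eq_iff fun_apply_simps)

lemma star_coeff_cpoly: "f \<in> cpoly \<Longrightarrow> g \<in> cpoly \<Longrightarrow> star_coeff L k f g \<in> cpoly"
  unfolding star_coeff_alt by (intro cpoly_mult cpoly.const normal_op_cpoly)

lemma star_coeff_assoc:
  assumes "f \<in> cpoly" "g \<in> cpoly" "h \<in> cpoly"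
  shows "(\<Sum>m\<le>r. star_coeff L m (star_coeff L (r - m) f g) h) =
    (\<Sum>m\<le>r. star_coeff L m f (star_coeff L (r - m) g h))"
proof -
  define c :: complex where "c = 1 / fact r * (1 / 2) ^ r"
  \<comment> \<open>The weights of the two nested coefficients combine to the weight of order
    \<open>r\<close> times a binomial coefficient.\<close>
  have c: "1 / fact m * (1 / 2) ^ m * (1 / fact (r - m) * (1 / 2) ^ (r - m)) = c * of_nat (r choose m)"
    if "m \<le> r" for m
    using that by (simp add: c_def binomial_fact field_simps flip: power_add)
  have "star_coeff L m (star_coeff L (r - m) f g) h =
      (\<lambda>_. c) * (of_nat (r choose m) * normal_op L m (normal_op L (r - m) f g) h)" if "m \<le> r" for m
    using assms c[OF that]
    by (simp add: star_coeff_alt normal_op_casimir_left const_casimirs normal_op_cpoly)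
       (simp add: fun_eq_iff fun_apply_simps flip: mult.assoc)
  moreover have "star_coeff L m f (star_coeff L (r - m) g h) =
      (\<lambda>_. c) * (of_nat (r choose m) * normal_op L m f (normal_op L (r - m) g h))" if "m \<le> r" for m
    using assms c[OF that]
    by (simp add: star_coeff_alt normal_op_casimir_right const_casimirs normal_op_cpoly)
       (simp add: fun_eq_iff fun_apply_simps flip: mult.assoc)
  ultimately show ?thesis
    using sum_nested_left[OF assms, of r] sum_nested_right[OF assms, of r]
    by (simp flip: sum_distrib_left)
qed

end

section \<open>The coefficients are Casimir functions\<close>

lemma sum_lists_2:
  fixes F :: "'n::finite list \<Rightarrow> 'b::comm_monoid_add"
  shows "(\<Sum>as | length as = 2. F as) = (\<Sum>a\<in>UNIV. \<Sum>b\<in>UNIV. F [a, b])"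
  by (simp add: numeral_2_eq_2 sum_lists_Suc)

text \<open>The left arrow of the second pair acts on \<open>f\<close> or on the first coefficient,
  the right arrow of the first pair on the second coefficient or on \<open>g\<close>. These two
  choices give the four terms.\<close>

lemma iterated_op_2:
  "iterated_op L 2 f g z = (\<Sum>a\<in>UNIV. \<Sum>a'\<in>UNIV. \<Sum>b\<in>UNIV. \<Sum>b'\<in>UNIV.
     pd a' (pd a f) z * L a b z * pd b (L a' b') z * pd b' g z
     + pd a f z * pd a' (L a b) z * pd b (L a' b') z * pd b' g z
     + pd a' (pd a f) z * L a b z * L a' b' z * pd b' (pd b g) z
     + pd a f z * pd a' (L a b) z * L a' b' z * pd b' (pd b g) z)"
proof -
  have "{Suc 0<..<Suc (Suc (Suc (Suc 0)))} = {Suc (Suc 0), Suc (Suc (Suc 0))}"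
    "{Suc (Suc 0)<..<Suc (Suc (Suc (Suc 0)))} = {Suc (Suc (Suc 0))}" by auto
  then have "arrows [(1, a, b), (2, a', b')] [f, L a b, L a' b', g] z =
     pd a' (pd a f) z * L a b z * pd b (L a' b') z * pd b' g z
     + pd a f z * pd a' (L a b) z * pd b (L a' b') z * pd b' g z
     + pd a' (pd a f) z * L a b z * L a' b' z * pd b' (pd b g) z
     + pd a f z * pd a' (L a b) z * L a' b' z * pd b' (pd b g) z" for a b a' b'
    by (simp add: numeral_2_eq_2 numeral_3_eq_3 mult.assoc)
  moreover have "zip [1..<Suc 2] (zip [a, a'] [b, b']) = [(1, a, b), (2, a', b')]" for a a' b b' :: 'a
    by (simp add: upt_rec)
  moreover have "f # map2 L [a, a'] [b, b'] @ [g] = [f, L a b, L a' b', g]" for a a' b b'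
    by simp
  ultimately show ?thesis
    unfolding iterated_op_def sum_lists_2 by (simp only:)
qed

lemma normal_op_2:
  "normal_op L 2 f g z = (\<Sum>a\<in>UNIV. \<Sum>a'\<in>UNIV. \<Sum>b\<in>UNIV. \<Sum>b'\<in>UNIV.
     L a b z * L a' b' z * pd a (pd a' f) z * pd b (pd b' g) z)"
  unfolding normal_op_def sum_lists_2 by (simp add: numeral_2_eq_2 mult.assoc)

text \<open>The double bracket of the coordinates \<open>p\<close>, \<open>q\<close> and
  \<open>c\<close>, nested to the right: the tensor \<open>T\<close> of the overview.\<close>

definition coeff_ham ::
  "('n::finite \<Rightarrow> 'n \<Rightarrow> complex ^ 'n \<Rightarrow> complex) \<Rightarrow> 'n \<Rightarrow> 'n \<Rightarrow> 'n \<Rightarrow> complex ^ 'n \<Rightarrow> complex" where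
  "coeff_ham L p q c z = (\<Sum>b\<in>UNIV. L p b z * pd b (L q c) z)"

text \<open>Second derivatives of \<open>f\<close> are symmetric, so the comparison of symbols sees
  the part of \<open>coeff_ham\<close> symmetric in \<open>p\<close> and \<open>q\<close>, and this
  part has to vanish.\<close>

lemma coeff_ham_antisym_12:
  fixes L :: "'n::finite \<Rightarrow> 'n \<Rightarrow> complex ^ 'n \<Rightarrow> complex"
  assumes ops: "\<And>f g. f \<in> cpoly \<Longrightarrow> g \<in> cpoly \<Longrightarrow> iterated_op L 2 f g z = normal_op L 2 f g z"
  shows "coeff_ham L p q c z = - coeff_ham L q p c z"
proof -
  define u where "u a = (\<lambda>w::complex ^ 'n. w $ a) + (\<lambda>_. - (z $ a))" for a
  have u: "u a \<in> cpoly" for a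
    unfolding u_def by (intro cpoly_add cpoly.coord cpoly.const)
  have pd_u: "pd b (u a) = (\<lambda>_. if b = a then 1 else 0)" for a b
    unfolding u_def by (simp add: pd_add cpoly.coord cpoly.const pd_coord pd_const)
  \<comment> \<open>\<open>f\<close> vanishes to second order at \<open>z\<close> and \<open>g\<close> is linear, so only the terms with two derivatives
    on \<open>f\<close> and one on \<open>g\<close> survive.\<close>
  define f where "f = u p * u q"
  define g where "g = (\<lambda>w::complex ^ 'n. w $ c)"
  have pd_f: "pd a f = (\<lambda>_. if a = p then 1 else 0) * u q + u p * (\<lambda>_. if a = q then 1 else 0)" for a
    by (simp add: f_def pd_mult u pd_u)
  have f1: "pd a f z = 0" for a
    by (simp add: pd_f fun_apply_simps u_def)
  have f2: "pd b (pd a f) z = (if b = q then if a = p then 1 else 0 else 0)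
      + (if b = p then if a = q then 1 else 0 else 0)" for a b
    by (simp add: pd_f pd_add pd_mult cpoly_mult cpoly.const u pd_u pd_const fun_apply_simps)
  have g2: "pd b' (pd b g) z = 0" for b b'
    by (simp add: g_def pd_coord pd_const fun_apply_simps)
  have inner: "(\<Sum>b\<in>UNIV. \<Sum>b'\<in>UNIV. H * L a b z * pd b (L a' b') z * pd b' g z) =
      H * coeff_ham L a a' c z" for H a a'
    by (simp add: g_def pd_coord coeff_ham_def sum_distrib_left mult.assoc
        if_distrib[of "\<lambda>x. _ * x"] cong: if_cong)
  have "iterated_op L 2 f g z =
      (\<Sum>a\<in>UNIV. \<Sum>a'\<in>UNIV. pd a' (pd a f) z * coeff_ham L a a' c z)"
    unfolding iterated_op_2 f1 g2 by (simp add: inner)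
  also have "\<dots> = coeff_ham L p q c z + coeff_ham L q p c z"
    by (simp add: f2 distrib_right sum.distrib if_distrib[of "\<lambda>x. x * _"] cong: if_cong)
  finally have "iterated_op L 2 f g z = coeff_ham L p q c z + coeff_ham L q p c z" .
  moreover have "normal_op L 2 f g z = 0"
    unfolding normal_op_2 g2 by simp
  moreover have "f \<in> cpoly" "g \<in> cpoly"
    unfolding f_def g_def by (intro cpoly_mult u cpoly.coord)+
  ultimately show ?thesis using ops[of f g] by (simp add: eq_neg_iff_add_eq_0)
qed

lemma bracket_coord: "bracket L (\<lambda>z. z $ b) f z = (\<Sum>e\<in>UNIV. L b e z * pd e f z)"
proof -
  have "bracket L (\<lambda>z. z $ b) f z = (\<Sum>a\<in>UNIV. if a = b then \<Sum>e\<in>UNIV. L a e z * pd e f z else 0)"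
    unfolding bracket_def by (intro sum.cong refl) (simp add: pd_coord)
  then show ?thesis by simp
qed

text \<open>Coordinates are sections of degree 1 on the punctured space, and the bracket of two of
  them is a coefficient of \<open>L\<close>. The Jacobi identity for three coordinates is thus the
  cyclic sum.\<close>

lemma jacobi_coeff_ham:
  assumes "jacobi L" and "z \<noteq> 0"
  shows "coeff_ham L a b c z + coeff_ham L b c a z + coeff_ham L c a b z = 0"
proof -
  have coord: "(\<lambda>w. w $ a) \<in> sections 1 (- {0 :: complex ^ 'a})" for a
    using homog_imp_H0[of "\<lambda>w. w $ a" 1] homog_coord[of a] by (simp add: H0_def)
  have "open_cone (- {0 :: complex ^ 'a})"
    by (auto simp: open_cone_def)
  moreover have "bracket L (\<lambda>w. w $ b) (\<lambda>w. w $ c) = L b c" for b c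
    by (rule ext)
      (simp add: bracket_coord pd_coord if_distrib[of "\<lambda>x. _ * x"] cong: if_cong)
  ultimately show ?thesis
    using assms(1)[unfolded jacobi_def, rule_format, OF coord[of a] coord[of b] coord[of c], of z]
      assms(2)
    by (simp add: bracket_coord coeff_ham_def)
qed

lemma casimir_coefficientsI:
  fixes L :: "'n::finite \<Rightarrow> 'n \<Rightarrow> complex ^ 'n \<Rightarrow> complex"
  assumes coeffs: "\<And>a b. L a b \<in> homog 2"
    and skew: "\<And>a b. L a b = - L b a"
    and jac: "jacobi L"
    and ops: "\<And>f g z. f \<in> cpoly \<Longrightarrow> g \<in> cpoly \<Longrightarrow> z \<noteq> 0 \<Longrightarrow>
      iterated_op L 2 f g z = normal_op L 2 f g z"
  shows "casimir_coefficients L"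
proof
  show "L a b \<in> cpoly" for a b using coeffs by (rule homog_cpoly)
  show "L a b = - L b a" for a b by (rule skew)
  have "coeff_ham L a b c z = 0" for a b c z
  proof (cases "z = 0")
    case True
    \<comment> \<open>Jacobi and the operator identity are available away from the origin. At the
      origin, degree 2 and the scalar 2 give \<open>L a b 0 = 4 * L a b 0\<close>.\<close>
    have "L a b 0 = 0" for a b
      using homog_scale[OF coeffs, of 2 a b 0] by simp
    then show ?thesis by (simp add: True coeff_ham_def)
  next
    case False
    have 12: "coeff_ham L a b c z = - coeff_ham L b a c z" for a b c
      by (rule coeff_ham_antisym_12) (rule ops[OF _ _ False])
    have 23: "coeff_ham L a b c z = - coeff_ham L a c b z" for a b c
      unfolding coeff_ham_def
      by (subst skew) (simp add: pd_uminus homog_cpoly[OF coeffs] uminus_apply sum_negf)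
    \<comment> \<open>The two antisymmetries make the three cyclic summands equal, so the Jacobi
      identity says that three times the tensor is zero.\<close>
    from jacobi_coeff_ham[OF jac False, of a b c] 12[of a b c] 12[of a c b] 23[of b c a] 23[of c a b]
      23[of a b c] 12[of c a b] 12[of b c a]
    show ?thesis by simp
  qed
  \<comment> \<open>The locale contracts the first index of the outer coefficient and
    \<open>coeff_ham\<close> the second; skewness converts one into the other.\<close>
  then show "(\<Sum>a\<in>UNIV. L a b * pd a (L c d)) = 0" for b c d
    by (subst skew) (simp add: fun_eq_iff sum_fun_apply fun_apply_simps coeff_ham_def sum_negf)
qed

section \<open>The star product of Laurent series\<close>

lemma star_nth: "star L f g $$ k = (if k < 0 then 0 else star_coeff L (nat k) f g)"
  by (simp add: star_def)

lemma star_nth_int: "star L f g $$ int k = star_coeff L k f g"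
  by (simp add: star_nth)

lemma star_coeff_zero: "star_coeff L k 0 g = 0" "star_coeff L k f 0 = 0"
  by (simp_all add: star_coeff_def normal_op_zero fun_eq_iff fun_apply_simps)

lemma star_zero: "star L 0 g $$ k = 0" "star L f 0 $$ k = 0"
  by (simp_all add: star_nth star_coeff_zero)

text \<open>Exchanging the arguments amounts to transposing the coefficient matrix. The right-hand
  laws are later deduced from the left-hand ones in this way.\<close>

lemma star_transpose: "star (\<lambda>a b. L b a) g f $$ k = star L f g $$ k"
proof -
  have "normal_op (\<lambda>a b. L b a) k g f = normal_op L k f g" for k
    unfolding normal_op_def by (subst sum.swap) (simp add: mult_ac)
  then show ?thesis by (simp add: star_nth star_coeff_def)
qed

text \<open>The range of \<open>j\<close> in \<open>star_ext\<close> depends on \<open>i\<close>. A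
  fixed rectangle that contains all nonzero terms can replace it, and then sums may be interchanged
  freely.\<close>

lemma star_ext_nth_box:
  assumes I: "finite I" and J: "finite J"
    and supp: "\<And>i j. F $$ i \<noteq> 0 \<Longrightarrow> G $$ j \<noteq> 0 \<Longrightarrow> i + j \<le> m \<Longrightarrow> i \<in> I \<and> j \<in> J"
  shows "star_ext L F G $$ m = (\<Sum>i\<in>I. \<Sum>j\<in>J. star L (F $$ i) (G $$ j) $$ (m - i - j))"
proof -
  define h where "h = (\<lambda>(i, j). star L (F $$ i) (G $$ j) $$ (m - i - j))"
  define D where "D = (SIGMA i:{fls_subdegree F..m - fls_subdegree G}. {fls_subdegree G..m - i})"
  have nz: "F $$ i \<noteq> 0 \<and> G $$ j \<noteq> 0 \<and> i + j \<le> m" if "h (i, j) \<noteq> 0" for i j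
  proof -
    have "F $$ i \<noteq> 0" "G $$ j \<noteq> 0" using that by (auto simp: h_def star_zero)
    moreover have "\<not> m - i - j < 0" using that by (auto simp: h_def star_nth)
    ultimately show ?thesis by simp
  qed
  have D: "(i, j) \<in> D" if "h (i, j) \<noteq> 0" for i j
    using nz[OF that] fls_eq0_below_subdegree[of i F] fls_eq0_below_subdegree[of j G]
    by (force simp: D_def)
  have IJ: "(i, j) \<in> I \<times> J" if "h (i, j) \<noteq> 0" for i j
    using nz[OF that] supp[of i j] by auto
  have "star_ext L F G $$ m = sum h D"
    unfolding star_ext_nth D_def h_def by (simp add: sum.Sigma)
  also have "\<dots> = sum h (I \<times> J)"
    using I J D IJ by (intro sum.mono_neutral_cong) (auto simp: D_def)
  also have "\<dots> = (\<Sum>i\<in>I. \<Sum>j\<in>J. star L (F $$ i) (G $$ j) $$ (m - i - j))"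
    by (simp add: h_def sum.cartesian_product)
  finally show ?thesis .
qed

lemma star_ext_below: "m < fls_subdegree F + fls_subdegree G \<Longrightarrow> star_ext L F G $$ m = 0"
  by (simp add: star_ext_nth)

lemma star_ext_transpose: "star_ext (\<lambda>a b. L b a) G F = star_ext L F G"
proof (rule fls_eqI)
  fix m
  define I where "I = {fls_subdegree F..m - fls_subdegree G}"
  define J where "J = {fls_subdegree G..m - fls_subdegree F}"
  have supp: "i \<in> I \<and> j \<in> J" if "F $$ i \<noteq> 0" "G $$ j \<noteq> 0" "i + j \<le> m" for i j
    using that fls_eq0_below_subdegree[of i F] fls_eq0_below_subdegree[of j G]
    by (force simp: I_def J_def)
  have "star_ext (\<lambda>a b. L b a) G F $$ m =
      (\<Sum>j\<in>J. \<Sum>i\<in>I. star (\<lambda>a b. L b a) (G $$ j) (F $$ i) $$ (m - j - i))"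
    by (rule star_ext_nth_box) (use supp in \<open>auto simp: I_def J_def add.commute\<close>)
  also have "\<dots> = (\<Sum>i\<in>I. \<Sum>j\<in>J. star L (F $$ i) (G $$ j) $$ (m - i - j))"
    by (subst sum.swap) (simp add: star_transpose[of L] algebra_simps)
  also have "\<dots> = star_ext L F G $$ m"
    by (rule star_ext_nth_box[symmetric]) (use supp in \<open>auto simp: I_def J_def\<close>)
  finally show "star_ext (\<lambda>a b. L b a) G F $$ m = star_ext L F G $$ m" .
qed

section \<open>Scalar Laurent series and reindexing of sums\<close>

lemma fls_times_nth_support:
  fixes f g :: "'a::{comm_monoid_add, mult_zero} fls"
  assumes E: "finite E" and supp: "\<And>i. f $$ i \<noteq> 0 \<Longrightarrow> g $$ (n - i) \<noteq> 0 \<Longrightarrow> i \<in> E"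
  shows "(f * g) $$ n = (\<Sum>i\<in>E. f $$ i * g $$ (n - i))"
proof -
  have "i \<in> {fls_subdegree f..n - fls_subdegree g} \<and> i \<in> E" if "f $$ i * g $$ (n - i) \<noteq> 0" for i
  proof -
    from that have "f $$ i \<noteq> 0" "g $$ (n - i) \<noteq> 0" by auto
    with supp[of i] show ?thesis
      using fls_subdegree_leI[of f i] fls_subdegree_leI[of g "n - i"] by auto
  qed
  then show ?thesis
    unfolding fls_times_nth(2) using E by (intro sum.mono_neutral_cong) auto
qed

lemma lscale_nth:
  assumes "finite E" and "\<And>e. c $$ e \<noteq> 0 \<Longrightarrow> F $$ (m - e) \<noteq> 0 \<Longrightarrow> e \<in> E"
  shows "lscale c F $$ m = (\<Sum>e\<in>E. (\<lambda>_. c $$ e) * F $$ (m - e))"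
  unfolding lscale_def
  by (subst fls_times_nth_support[OF assms(1)]) (use assms(2) in \<open>auto simp: const_fls_nth zero_fun_def\<close>)

lemma lscale_below: "m < fls_subdegree c + fls_subdegree F \<Longrightarrow> lscale c F $$ m = 0"
proof -
  assume m: "m < fls_subdegree c + fls_subdegree F"
  have "lscale c F $$ m = (\<Sum>e\<in>{}. (\<lambda>_. c $$ e) * F $$ (m - e))"
  proof (rule lscale_nth)
    fix e assume "c $$ e \<noteq> 0" "F $$ (m - e) \<noteq> 0"
    then have "fls_subdegree c \<le> e" "fls_subdegree F \<le> m - e" by (auto intro: fls_subdegree_leI)
    with m show "e \<in> {}" by simp
  qed simp
  then show ?thesis by simp
qed

text \<open>In the associativity proof \<open>p\<close> is the exponent of an intermediate product,
  and \<open>u - p\<close> and \<open>p - v\<close> are the outer and inner orders. Their sum is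
  fixed, so summing over \<open>p\<close> means summing over all splittings of the total order
  \<open>n\<close>.\<close>

lemma sum_antidiagonal_int:
  fixes \<Phi> :: "int \<Rightarrow> int \<Rightarrow> 'b::comm_monoid_add"
  assumes h: "\<And>p. p \<in> P \<Longrightarrow> h p = \<Phi> (u - p) (p - v)"
    and P: "finite P" "{v..u} \<subseteq> P" and n: "n = u - v"
    and zero: "\<And>x y. x < 0 \<or> y < 0 \<Longrightarrow> \<Phi> x y = 0"
  shows "(\<Sum>p\<in>P. h p) =
    (if n < 0 then 0 else \<Sum>k\<le>nat n. \<Phi> (int k) (int (nat n - k)))"
proof -
  have "(\<Sum>p\<in>P. h p) = (\<Sum>p\<in>P. \<Phi> (u - p) (p - v))"
    using h by (rule sum.cong[OF refl])
  also have "\<dots> = (\<Sum>p\<in>{v..u}. \<Phi> (u - p) (p - v))"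
    using P by (intro sum.mono_neutral_right) (auto intro: zero)
  also have "\<dots> = (if u < v then 0 else \<Sum>k\<le>nat (u - v). \<Phi> (int k) (int (nat (u - v) - k)))"
  proof (cases "u < v")
    case False
    then have "(\<Sum>p\<in>{v..u}. \<Phi> (u - p) (p - v)) =
        (\<Sum>k\<le>nat (u - v). \<Phi> (int k) (int (nat (u - v) - k)))"
      by (intro sum.reindex_bij_witness[of _ "\<lambda>k. u - int k" "\<lambda>p. nat (u - p)"])
        (auto simp: of_nat_diff nat_le_iff)
    with False show ?thesis by simp
  qed simp
  finally show ?thesis by (simp add: n)
qed

lemma sum_shift_support:
  fixes h :: "int \<Rightarrow> 'b::comm_monoid_add"
  assumes "finite P" "finite I" and "\<And>p. h p \<noteq> 0 \<Longrightarrow> p \<in> P \<and> p - e \<in> I"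
  shows "(\<Sum>p\<in>P. h p) = (\<Sum>i\<in>I. h (i + e))"
proof -
  have "(\<Sum>i\<in>I. h (i + e)) = sum h ((\<lambda>i. i + e) ` I)"
    by (subst sum.reindex) (auto simp: inj_on_def)
  also have "\<dots> = sum h P"
    using assms by (intro sum.mono_neutral_cong) force+
  finally show ?thesis by simp
qed

section \<open>Bilinearity and associativity over Laurent series\<close>

context casimir_coefficients
begin

lemma star_nth_cpoly: "f \<in> cpoly \<Longrightarrow> g \<in> cpoly \<Longrightarrow> star L f g $$ k \<in> cpoly"
  by (simp add: star_nth star_coeff_cpoly cpoly_0)

lemma star_ext_nth_cpoly:
  "\<forall>i. F $$ i \<in> cpoly \<Longrightarrow> \<forall>j. G $$ j \<in> cpoly \<Longrightarrow> star_ext L F G $$ m \<in> cpoly"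
  unfolding star_ext_nth by (intro cpoly_sum star_nth_cpoly) auto

lemma star_sum_left:
  "(\<And>i. i \<in> A \<Longrightarrow> F i \<in> cpoly) \<Longrightarrow> h \<in> cpoly \<Longrightarrow>
    star L (\<Sum>i\<in>A. F i) h $$ k = (\<Sum>i\<in>A. star L (F i) h $$ k)"
  by (simp add: star_nth star_coeff_alt normal_op_sum_left sum_distrib_left)

lemma star_sum_right:
  "(\<And>i. i \<in> A \<Longrightarrow> F i \<in> cpoly) \<Longrightarrow> h \<in> cpoly \<Longrightarrow>
    star L h (\<Sum>i\<in>A. F i) $$ k = (\<Sum>i\<in>A. star L h (F i) $$ k)"
  by (simp add: star_nth star_coeff_alt normal_op_sum_right sum_distrib_left)

lemma star_add_left:
  "f \<in> cpoly \<Longrightarrow> g \<in> cpoly \<Longrightarrow> h \<in> cpoly \<Longrightarrow>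
    star L (f + g) h $$ k = star L f h $$ k + star L g h $$ k"
  by (simp add: star_nth star_coeff_alt normal_op_add_left distrib_left)

lemma star_scale_left:
  "f \<in> cpoly \<Longrightarrow> h \<in> cpoly \<Longrightarrow> star L ((\<lambda>_. c) * f) h $$ k = (\<lambda>_. c) * star L f h $$ k"
  by (simp add: star_nth star_coeff_alt normal_op_casimir_left const_casimirs mult.left_commute)

lemma star_ext_add_left:
  assumes "\<forall>i. F $$ i \<in> cpoly" "\<forall>i. G $$ i \<in> cpoly" "\<forall>i. H $$ i \<in> cpoly"
  shows "star_ext L (F + G) H = star_ext L F H + star_ext L G H"
proof (rule fls_eqI)
  fix m
  define a where "a = min (fls_subdegree F) (fls_subdegree G)"
  define I where "I = {a..m - fls_subdegree H}"
  define J where "J = {fls_subdegree H..m - a}"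
  have box: "star_ext L K H $$ m = (\<Sum>i\<in>I. \<Sum>j\<in>J. star L (K $$ i) (H $$ j) $$ (m - i - j))"
    if "\<And>i. i < a \<Longrightarrow> K $$ i = 0" for K
  proof (rule star_ext_nth_box)
    fix i j assume "K $$ i \<noteq> 0" "H $$ j \<noteq> 0" "i + j \<le> m"
    then show "i \<in> I \<and> j \<in> J"
      using that[of i] fls_eq0_below_subdegree[of j H] by (force simp: I_def J_def)
  qed (simp_all add: I_def J_def)
  have "star_ext L (F + G) H $$ m =
      (\<Sum>i\<in>I. \<Sum>j\<in>J. star L (F $$ i + G $$ i) (H $$ j) $$ (m - i - j))"
    by (subst box) (simp_all add: a_def fls_eq0_below_subdegree)
  also have "\<dots> = (\<Sum>i\<in>I. \<Sum>j\<in>J. star L (F $$ i) (H $$ j) $$ (m - i - j)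
      + star L (G $$ i) (H $$ j) $$ (m - i - j))"
    using assms by (simp add: star_add_left)
  also have "\<dots> = star_ext L F H $$ m + star_ext L G H $$ m"
    by (subst (1 2) box) (simp_all add: a_def fls_eq0_below_subdegree sum.distrib)
  finally show "star_ext L (F + G) H $$ m = (star_ext L F H + star_ext L G H) $$ m" by simp
qed

lemma star_ext_lscale_left:
  assumes F: "\<forall>i. F $$ i \<in> cpoly" and G: "\<forall>i. G $$ i \<in> cpoly"
  shows "star_ext L (lscale c F) G = lscale c (star_ext L F G)"
proof (rule fls_eqI)
  fix m
  define d where "d = fls_subdegree c"
  define a where "a = fls_subdegree F"
  define b where "b = fls_subdegree G"
  \<comment> \<open>The sets \<open>E\<close>, \<open>P\<close>, \<open>I\<close>, \<open>J\<close>
    contain the exponents of \<open>c\<close>, of the scaled series, of \<open>F\<close> and of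
    \<open>G\<close> that can reach \<open>m\<close>. An upper bound is \<open>m\<close> minus the
    lowest exponents of the other factors.\<close>
  define E where "E = {d..m - a - b}"
  define P where "P = {d + a..m - b}"
  define I where "I = {a..m - d - b}"
  define J where "J = {b..m - d - a}"
  have c0: "c $$ e = 0" if "e < d" for e using that by (simp add: d_def)
  have F0: "F $$ i = 0" if "i < a" for i using that by (simp add: a_def)
  have G0: "G $$ j = 0" if "j < b" for j using that by (simp add: b_def)
  have scaled: "lscale c F $$ p = (\<Sum>e\<in>E. (\<lambda>_. c $$ e) * F $$ (p - e))" if "p \<in> P" for p
  proof (rule lscale_nth)
    fix e assume "c $$ e \<noteq> 0" "F $$ (p - e) \<noteq> 0"
    then show "e \<in> E" using c0[of e] F0[of "p - e"] that by (force simp: E_def P_def)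
  qed (simp add: E_def)
  have "star_ext L (lscale c F) G $$ m =
      (\<Sum>p\<in>P. \<Sum>j\<in>J. star L (lscale c F $$ p) (G $$ j) $$ (m - p - j))"
  proof (rule star_ext_nth_box)
    fix p j assume "lscale c F $$ p \<noteq> 0" "G $$ j \<noteq> 0" "p + j \<le> m"
    then show "p \<in> P \<and> j \<in> J"
      using lscale_below[of p c F] G0[of j] by (force simp: P_def J_def d_def a_def)
  qed (simp_all add: P_def J_def)
  also have "\<dots> = (\<Sum>p\<in>P. \<Sum>j\<in>J. \<Sum>e\<in>E. (\<lambda>_. c $$ e) * star L (F $$ (p - e)) (G $$ j) $$ (m - p - j))"
    using F G by (simp add: scaled star_sum_left cpoly_mult cpoly.const star_scale_left)
  also have "\<dots> = (\<Sum>p\<in>P. \<Sum>e\<in>E. \<Sum>j\<in>J. (\<lambda>_. c $$ e) * star L (F $$ (p - e)) (G $$ j) $$ (m - p - j))"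
    by (rule sum.cong[OF refl], rule sum.swap)
  also have "\<dots> = (\<Sum>e\<in>E. \<Sum>p\<in>P. \<Sum>j\<in>J. (\<lambda>_. c $$ e) * star L (F $$ (p - e)) (G $$ j) $$ (m - p - j))"
    by (rule sum.swap)
  also have "\<dots> = (\<Sum>e\<in>E. (\<lambda>_. c $$ e) * star_ext L F G $$ (m - e))"
  proof (rule sum.cong[OF refl])
    fix e assume e: "e \<in> E"
    have "(\<Sum>p\<in>P. \<Sum>j\<in>J. star L (F $$ (p - e)) (G $$ j) $$ (m - p - j)) =
        (\<Sum>j\<in>J. \<Sum>p\<in>P. star L (F $$ (p - e)) (G $$ j) $$ (m - p - j))"
      by (rule sum.swap)
    \<comment> \<open>The exponent \<open>p\<close> of the scaled series is replaced by
      \<open>i + e\<close>, with \<open>i\<close> the exponent taken from \<open>F\<close>.\<close>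
    also have "\<dots> = (\<Sum>j\<in>J. \<Sum>i\<in>I. star L (F $$ (i + e - e)) (G $$ j) $$ (m - (i + e) - j))"
    proof (rule sum.cong[OF refl], rule sum_shift_support)
      fix j p assume j: "j \<in> J" and nz: "star L (F $$ (p - e)) (G $$ j) $$ (m - p - j) \<noteq> 0"
      have "F $$ (p - e) \<noteq> 0" using nz by (auto simp: star_zero)
      moreover have "\<not> m - p - j < 0" using nz by (auto simp: star_nth)
      ultimately show "p \<in> P \<and> p - e \<in> I"
        using e j F0[of "p - e"] by (force simp: E_def I_def J_def P_def)
    qed (simp_all add: P_def I_def)
    also have "\<dots> = (\<Sum>i\<in>I. \<Sum>j\<in>J. star L (F $$ i) (G $$ j) $$ (m - e - i - j))"
      by (subst sum.swap) (simp add: algebra_simps)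
    also have "\<dots> = star_ext L F G $$ (m - e)"
    proof (rule star_ext_nth_box[symmetric])
      fix i j assume "F $$ i \<noteq> 0" "G $$ j \<noteq> 0" "i + j \<le> m - e"
      then show "i \<in> I \<and> j \<in> J" using e F0[of i] G0[of j] by (force simp: E_def I_def J_def)
    qed (simp_all add: I_def J_def)
    finally show "(\<Sum>p\<in>P. \<Sum>j\<in>J. (\<lambda>_. c $$ e) * star L (F $$ (p - e)) (G $$ j) $$ (m - p - j)) =
        (\<lambda>_. c $$ e) * star_ext L F G $$ (m - e)"
      by (simp flip: sum_distrib_left)
  qed
  also have "\<dots> = lscale c (star_ext L F G) $$ m"
  proof (rule lscale_nth[symmetric])
    fix e assume "c $$ e \<noteq> 0" "star_ext L F G $$ (m - e) \<noteq> 0"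
    then show "e \<in> E"
      using c0[of e] star_ext_below[of "m - e" F G L] by (force simp: E_def a_def b_def)
  qed (simp add: E_def)
  finally show "star_ext L (lscale c F) G $$ m = lscale c (star_ext L F G) $$ m" .
qed

text \<open>Both bracketings are rearranged into one sum over the exponents of the three series.
  Associativity is then applied for each total order separately.\<close>

lemma star_ext_assoc:
  assumes F: "\<forall>i. F $$ i \<in> cpoly" and G: "\<forall>i. G $$ i \<in> cpoly" and H: "\<forall>i. H $$ i \<in> cpoly"
  shows "star_ext L (star_ext L F G) H = star_ext L F (star_ext L G H)"
proof (rule fls_eqI)
  fix m
  define a where "a = fls_subdegree F"
  define b where "b = fls_subdegree G"
  define c where "c = fls_subdegree H"
  define I where "I = {a..m - b - c}"
  define J where "J = {b..m - a - c}"
  define K where "K = {c..m - a - b}"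
  \<comment> \<open>\<open>P\<close> and \<open>Q\<close> contain the exponents of the intermediate
    products of \<open>F\<close> with \<open>G\<close> and of \<open>G\<close> with
    \<open>H\<close>.\<close>
  define P where "P = {a + b..m - c}"
  define Q where "Q = {b + c..m - a}"
  note defs = I_def J_def K_def P_def Q_def
  have F0: "F $$ i = 0" if "i < a" for i using that by (simp add: a_def)
  have G0: "G $$ i = 0" if "i < b" for i using that by (simp add: b_def)
  have H0: "H $$ i = 0" if "i < c" for i using that by (simp add: c_def)
  \<comment> \<open>The contribution to the exponent \<open>m\<close> of the left-bracketed product
    of three fixed coefficients; the conditional sets it to zero when the remaining order is
    negative.\<close>
  define Z where "Z i j l = (if m - i - j - l < 0 then 0 else
      \<Sum>k\<le>nat (m - i - j - l). star_coeff L k (star_coeff L (nat (m - i - j - l) - k) (F $$ i) (G $$ j)) (H $$ l))"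
    for i j l
  have "star_ext L (star_ext L F G) H $$ m =
      (\<Sum>p\<in>P. \<Sum>l\<in>K. star L (star_ext L F G $$ p) (H $$ l) $$ (m - p - l))"
  proof (rule star_ext_nth_box)
    fix p l assume "star_ext L F G $$ p \<noteq> 0" "H $$ l \<noteq> 0" "p + l \<le> m"
    then show "p \<in> P \<and> l \<in> K"
      using star_ext_below[of p F G L] H0[of l] by (force simp: defs a_def b_def)
  qed (simp_all add: defs)
  also have "\<dots> = (\<Sum>p\<in>P. \<Sum>l\<in>K. \<Sum>i\<in>I. \<Sum>j\<in>J.
      star L (star L (F $$ i) (G $$ j) $$ (p - i - j)) (H $$ l) $$ (m - p - l))"
  proof (intro sum.cong refl)
    fix p l assume p: "p \<in> P"
    have "star_ext L F G $$ p = (\<Sum>i\<in>I. \<Sum>j\<in>J. star L (F $$ i) (G $$ j) $$ (p - i - j))"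
    proof (rule star_ext_nth_box)
      fix i j assume "F $$ i \<noteq> 0" "G $$ j \<noteq> 0" "i + j \<le> p"
      then show "i \<in> I \<and> j \<in> J" using p F0[of i] G0[of j] by (force simp: defs)
    qed (simp_all add: defs)
    then show "star L (star_ext L F G $$ p) (H $$ l) $$ (m - p - l) = (\<Sum>i\<in>I. \<Sum>j\<in>J.
        star L (star L (F $$ i) (G $$ j) $$ (p - i - j)) (H $$ l) $$ (m - p - l))"
      using F G H by (simp add: star_sum_left cpoly_sum star_nth_cpoly)
  qed
  also have "\<dots> = (\<Sum>l\<in>K. \<Sum>i\<in>I. \<Sum>j\<in>J. \<Sum>p\<in>P.
      star L (star L (F $$ i) (G $$ j) $$ (p - i - j)) (H $$ l) $$ (m - p - l))"
    by (subst sum.swap, rule sum.cong[OF refl], subst sum.swap, rule sum.cong[OF refl], rule sum.swap)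
  also have "\<dots> = (\<Sum>l\<in>K. \<Sum>i\<in>I. \<Sum>j\<in>J. Z i j l)"
  proof (intro sum.cong refl)
    fix i j l assume ijl: "i \<in> I" "j \<in> J" "l \<in> K"
    show "(\<Sum>p\<in>P. star L (star L (F $$ i) (G $$ j) $$ (p - i - j)) (H $$ l) $$ (m - p - l)) = Z i j l"
      unfolding Z_def star_nth_int[symmetric]
      by (rule sum_antidiagonal_int[where u = "m - l" and v = "i + j" and
            \<Phi> = "\<lambda>x y. star L (star L (F $$ i) (G $$ j) $$ y) (H $$ l) $$ x"])
        (use ijl in \<open>auto simp: defs algebra_simps star_nth star_coeff_zero\<close>)
  qed
  also have "\<dots> = (\<Sum>i\<in>I. \<Sum>j\<in>J. \<Sum>l\<in>K. Z i j l)"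
    by (subst sum.swap, rule sum.cong[OF refl], rule sum.swap)
  also have "\<dots> = (\<Sum>i\<in>I. \<Sum>j\<in>J. \<Sum>l\<in>K. \<Sum>q\<in>Q.
      star L (F $$ i) (star L (G $$ j) (H $$ l) $$ (q - j - l)) $$ (m - i - q))"
  proof (intro sum.cong refl)
    fix i j l assume ijl: "i \<in> I" "j \<in> J" "l \<in> K"
    have "Z i j l = (if m - i - j - l < 0 then 0 else
        \<Sum>k\<le>nat (m - i - j - l). star_coeff L k (F $$ i) (star_coeff L (nat (m - i - j - l) - k) (G $$ j) (H $$ l)))"
      unfolding Z_def using F G H by (simp add: star_coeff_assoc)
    also have "\<dots> = (\<Sum>q\<in>Q. star L (F $$ i) (star L (G $$ j) (H $$ l) $$ (q - j - l)) $$ (m - i - q))"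
      unfolding star_nth_int[symmetric]
      by (rule sum_antidiagonal_int[symmetric, where u = "m - i" and v = "j + l" and
            \<Phi> = "\<lambda>x y. star L (F $$ i) (star L (G $$ j) (H $$ l) $$ y) $$ x"])
        (use ijl in \<open>auto simp: defs algebra_simps star_nth star_coeff_zero\<close>)
    finally show "Z i j l = (\<Sum>q\<in>Q. star L (F $$ i) (star L (G $$ j) (H $$ l) $$ (q - j - l)) $$ (m - i - q))" .
  qed
  also have "\<dots> = (\<Sum>i\<in>I. \<Sum>q\<in>Q. \<Sum>j\<in>J. \<Sum>l\<in>K.
      star L (F $$ i) (star L (G $$ j) (H $$ l) $$ (q - j - l)) $$ (m - i - q))"
    by (rule sum.cong[OF refl], subst (2) sum.swap, rule sum.cong[OF refl], rule sum.swap)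
  also have "\<dots> = (\<Sum>i\<in>I. \<Sum>q\<in>Q. star L (F $$ i) (star_ext L G H $$ q) $$ (m - i - q))"
  proof (intro sum.cong refl)
    fix i q assume q: "q \<in> Q"
    have "star_ext L G H $$ q = (\<Sum>j\<in>J. \<Sum>l\<in>K. star L (G $$ j) (H $$ l) $$ (q - j - l))"
    proof (rule star_ext_nth_box)
      fix j l assume "G $$ j \<noteq> 0" "H $$ l \<noteq> 0" "j + l \<le> q"
      then show "j \<in> J \<and> l \<in> K" using q G0[of j] H0[of l] by (force simp: defs)
    qed (simp_all add: defs)
    then show "(\<Sum>j\<in>J. \<Sum>l\<in>K. star L (F $$ i) (star L (G $$ j) (H $$ l) $$ (q - j - l)) $$ (m - i - q)) =
        star L (F $$ i) (star_ext L G H $$ q) $$ (m - i - q)"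
      using F G H by (simp add: star_sum_right cpoly_sum star_nth_cpoly)
  qed
  also have "\<dots> = star_ext L F (star_ext L G H) $$ m"
  proof (rule star_ext_nth_box[symmetric])
    fix i q assume "F $$ i \<noteq> 0" "star_ext L G H $$ q \<noteq> 0" "i + q \<le> m"
    then show "i \<in> I \<and> q \<in> Q"
      using star_ext_below[of q G H L] F0[of i] by (force simp: defs b_def c_def)
  qed (simp_all add: defs)
  finally show "star_ext L (star_ext L F G) H $$ m = star_ext L F (star_ext L G H) $$ m" .
qed

text \<open>The third assumption survives because skewness changes both occurrences of
  \<open>L\<close> by a sign only.\<close>

lemma transpose: "casimir_coefficients (\<lambda>a b. L b a)"
proof
  show "L b a \<in> cpoly" for a b by (rule coeff_cpoly)
  show "L b a = - L a b" for a b by (rule skew)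
  show "(\<Sum>a\<in>UNIV. L b a * pd a (L d c)) = 0" for b c d
    using coeff_casimir[of b d c] by (subst skew) (simp add: sum_negf)
qed

lemma star_ext_add_right:
  assumes "\<forall>i. F $$ i \<in> cpoly" "\<forall>i. G $$ i \<in> cpoly" "\<forall>i. H $$ i \<in> cpoly"
  shows "star_ext L H (F + G) = star_ext L H F + star_ext L H G"
  using casimir_coefficients.star_ext_add_left[OF transpose assms]
  by (simp only: star_ext_transpose[of L])

lemma star_ext_lscale_right:
  assumes "\<forall>i. F $$ i \<in> cpoly" "\<forall>i. G $$ i \<in> cpoly"
  shows "star_ext L F (lscale c G) = lscale c (star_ext L F G)"
  using casimir_coefficients.star_ext_lscale_left[OF transpose assms(2,1)]
  by (simp only: star_ext_transpose[of L])

lemma bilinear_assoc_laurent_series: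
  "bilinear_assoc_on (laurent_series UNIV) lscale (laurent_series cpoly) (star_ext L)"
  by (simp add: bilinear_assoc_on_def laurent_series_def star_ext_nth_cpoly star_ext_add_left
      star_ext_add_right star_ext_lscale_left star_ext_lscale_right star_ext_assoc)

end

section \<open>Evaluation of the formal parameter\<close>

text \<open>Each coefficient raises the degree by 2, and the two derivatives that come with it lower
  it by 2.\<close>

lemma normal_op_homog:
  assumes L: "\<And>a b. L a b \<in> homog 2"
  shows "f \<in> homog d \<Longrightarrow> g \<in> homog e \<Longrightarrow> normal_op L k f g \<in> homog (d + e)"
proof (induction k arbitrary: f g d e)
  case 0
  then show ?case by (simp add: normal_op_0 homog_mult)
next
  case (Suc k)
  have "L a b * normal_op L k (pd a f) (pd b g) \<in> homog (2 + ((d - 1) + (e - 1)))" for a b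
    by (intro homog_mult L Suc.IH homog_pd Suc.prems)
  then show ?case
    using Suc.prems by (auto simp: normal_op_Suc homog_cpoly intro!: homog_sum)
qed

lemma cpoly_homog_components:
  assumes "f \<in> cpoly"
  shows "\<exists>N h. (\<forall>k. h k \<in> homog (int k)) \<and> f = (\<Sum>k\<le>N. h k)"
proof -
  obtain N h where h: "\<forall>k\<le>N. h k \<in> H0 k" "f = (\<lambda>z. \<Sum>k\<le>N. h k z)"
    using assms unfolding sum_H0_eq_cpoly[symmetric] sum_H0_def by blast
  define h' where "h' k = (if k \<le> N then h k else 0)" for k
  have "f = (\<Sum>k\<le>N. h' k)"
    unfolding h(2) by (rule ext) (simp add: sum_fun_apply h'_def)
  moreover have "\<forall>k. h' k \<in> homog (int k)"
    using h(1) by (simp add: h'_def H0_eq_homog homog_0)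
  ultimately show ?thesis by blast
qed

lemma cpoly_pds_eventually_0:
  assumes "f \<in> cpoly"
  shows "\<exists>N. \<forall>as. length as > N \<longrightarrow> pds as f = 0"
proof -
  obtain N h where h: "\<forall>k. h k \<in> homog (int k)" and f: "f = (\<Sum>k\<le>N. h k)"
    using cpoly_homog_components[OF assms] by blast
  have hc: "h k \<in> cpoly" for k
    using h homog_cpoly by blast
  have sum: "pds as (\<Sum>k\<le>N. h k) = (\<Sum>k\<le>N. pds as (h k))" for as
    by (induction as) (simp_all add: pd_sum pds_cpoly hc)
  have "pds as f = 0" if "length as > N" for as
    unfolding f sum using that by (intro sum.neutral ballI pds_homog_eq_0[OF h[rule_format]]) simp
  then show ?thesis by blast
qed

text \<open>Already the high derivatives of \<open>f\<close> vanish, so the bound is uniform in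
  \<open>g\<close>.\<close>

lemma normal_op_eventually_0:
  assumes "f \<in> cpoly"
  shows "\<exists>N. \<forall>k>N. \<forall>g. normal_op L k f g = 0"
proof -
  obtain N where N: "length as > N \<Longrightarrow> pds as f = 0" for as
    using cpoly_pds_eventually_0[OF assms] by blast
  have "normal_op L k f g = 0" if "k > N" for k g
    using that N by (simp add: normal_op_def fun_eq_iff fun_apply_simps)
  then show ?thesis by blast
qed

text \<open>The series terminates pointwise, so convergence is automatic and the product becomes a
  finite sum in the ring of functions.\<close>

lemma star_at_finite:
  assumes "\<forall>k>N. normal_op L k f g = 0"
  shows "star_at L c f g = (\<Sum>k\<le>N. (\<lambda>_. c ^ k) * star_coeff L k f g)"
proof
  fix z
  have "star_at L c f g z = (\<Sum>k\<le>N. 1 / fact k * (c / 2) ^ k * normal_op L k f g z)"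
    unfolding star_at_def
    by (rule suminf_finite) (use assms in \<open>auto simp: not_le fun_apply_simps\<close>)
  also have "\<dots> = (\<Sum>k\<le>N. (\<lambda>_. c ^ k) * star_coeff L k f g) z"
    by (simp add: sum_fun_apply fun_apply_simps star_coeff_def power_divide mult_ac)
  finally show "star_at L c f g z = (\<Sum>k\<le>N. (\<lambda>_. c ^ k) * star_coeff L k f g) z" .
qed

lemma eval_at_finite:
  assumes "finite M" and "\<And>m. F $$ m \<noteq> 0 \<Longrightarrow> m \<in> M"
  shows "eval_at c F = (\<Sum>m\<in>M. (\<lambda>_. c powi m) * F $$ m)"
proof
  fix z
  have "eval_at c F z = (\<Sum>m\<in>M. c powi m * (F $$ m) z)"
    unfolding eval_at_def
    by (rule sum.mono_neutral_left) (use assms in \<open>auto simp: fun_apply_simps\<close>)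
  then show "eval_at c F z = (\<Sum>m\<in>M. (\<lambda>_. c powi m) * F $$ m) z"
    by (simp add: sum_fun_apply fun_apply_simps)
qed

lemma eval_at_fls_const: "eval_at c (fls_const f) = f"
  by (subst eval_at_finite[of "{0}"]) (auto simp: fun_eq_iff fun_apply_simps split: if_splits)

lemma star_ext_fls_const: "star_ext L (fls_const f) (fls_const g) = star L f g"
  by (rule fls_eqI, subst star_ext_nth_box[of "{0}" "{0}"]) (auto split: if_splits)

lemma fls_const_laurent_polys: "f \<in> cpoly \<Longrightarrow> fls_const f \<in> laurent_polys cpoly"
proof -
  assume "f \<in> cpoly"
  moreover have "finite {m. fls_const f $$ m \<noteq> 0}"
    by (rule finite_subset[of _ "{0}"]) auto
  ultimately show ?thesis by (simp add: laurent_polys_def laurent_series_def cpoly_0)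
qed

lemma laurent_polysD:
  assumes "F \<in> laurent_polys A"
  shows "F $$ i \<in> A" and "finite {m. F $$ m \<noteq> 0}"
  using assms by (simp_all add: laurent_polys_def laurent_series_def)

section \<open>Specialization of Laurent polynomials\<close>

context casimir_coefficients
begin

lemma laurent_polys_bound:
  assumes F: "F \<in> laurent_polys cpoly"
  shows "\<exists>N. \<forall>i. \<forall>k>N. \<forall>g. normal_op L k (F $$ i) g = 0"
proof -
  have "\<exists>N. \<forall>i. \<forall>k>N i. \<forall>g. normal_op L k (F $$ i) g = 0"
    using normal_op_eventually_0[OF laurent_polysD(1)[OF F]] by (intro choice allI)
  then obtain N where N: "\<And>i k g. k > N i \<Longrightarrow> normal_op L k (F $$ i) g = 0" by blast
  \<comment> \<open>Only finitely many coefficients are nonzero, so the maximum of their bounds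
    serves them all. The inserted 0 covers the zero series.\<close>
  define M where "M = Max (insert 0 (N ` {i. F $$ i \<noteq> 0}))"
  have "normal_op L k (F $$ i) g = 0" if "k > M" for i k g
  proof (cases "F $$ i = 0")
    case False
    then have "N i \<le> M"
      unfolding M_def by (intro Max_ge) (simp_all add: laurent_polysD(2)[OF F])
    with N[of i k g] that show ?thesis by simp
  qed (simp add: normal_op_zero)
  then show ?thesis by blast
qed

lemma star_ext_support:
  assumes F: "F \<in> laurent_polys cpoly" and G: "G \<in> laurent_polys cpoly"
    and N: "\<forall>i. \<forall>k>N. \<forall>g. normal_op L k (F $$ i) g = 0"
    and nz: "star_ext L F G $$ m \<noteq> 0"
  shows "m \<in> (\<lambda>(i, j, k). i + j + int k) ` ({i. F $$ i \<noteq> 0} \<times> {j. G $$ j \<noteq> 0} \<times> {..N})"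
proof -
  have "star_ext L F G $$ m =
      (\<Sum>i | F $$ i \<noteq> 0. \<Sum>j | G $$ j \<noteq> 0. star L (F $$ i) (G $$ j) $$ (m - i - j))"
    by (rule star_ext_nth_box) (simp_all add: laurent_polysD(2)[OF F] laurent_polysD(2)[OF G])
  with nz have "\<exists>i\<in>{i. F $$ i \<noteq> 0}. \<exists>j\<in>{j. G $$ j \<noteq> 0}. star L (F $$ i) (G $$ j) $$ (m - i - j) \<noteq> 0"
    by (metis (mono_tags, lifting) sum.neutral)
  then obtain i j where ij: "F $$ i \<noteq> 0" "G $$ j \<noteq> 0" "star L (F $$ i) (G $$ j) $$ (m - i - j) \<noteq> 0"
    by blast
  define k where "k = nat (m - i - j)"
  have m: "m = i + j + int k" and k: "star_coeff L k (F $$ i) (G $$ j) \<noteq> 0"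
    using ij(3) by (auto simp: star_nth k_def split: if_splits)
  have "k \<le> N"
  proof (rule ccontr)
    assume "\<not> k \<le> N"
    with N k show False by (simp add: star_coeff_alt)
  qed
  with ij m show ?thesis by (intro image_eqI[of _ _ "(i, j, k)"]) auto
qed

lemma star_ext_laurent_polys:
  assumes F: "F \<in> laurent_polys cpoly" and G: "G \<in> laurent_polys cpoly"
  shows "star_ext L F G \<in> laurent_polys cpoly"
proof -
  obtain N where N: "\<forall>i. \<forall>k>N. \<forall>g. normal_op L k (F $$ i) g = 0"
    using laurent_polys_bound[OF F] by blast
  have "{m. star_ext L F G $$ m \<noteq> 0} \<subseteq>
      (\<lambda>(i, j, k). i + j + int k) ` ({i. F $$ i \<noteq> 0} \<times> {j. G $$ j \<noteq> 0} \<times> {..N})"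
    using star_ext_support[OF F G N] by blast
  then have "finite {m. star_ext L F G $$ m \<noteq> 0}"
    by (rule finite_subset) (simp add: laurent_polysD(2)[OF F] laurent_polysD(2)[OF G])
  then show ?thesis
    using laurent_polysD(1)[OF F] laurent_polysD(1)[OF G]
    by (simp add: laurent_polys_def laurent_series_def star_ext_nth_cpoly)
qed

lemma bilinear_assoc_laurent_polys:
  "bilinear_assoc_on (laurent_polys UNIV) lscale (laurent_polys cpoly) (star_ext L)"
  by (simp add: bilinear_assoc_on_def star_ext_laurent_polys laurent_polysD(1) star_ext_add_left
      star_ext_add_right star_ext_lscale_left star_ext_lscale_right star_ext_assoc)

lemma star_coeff_const_left:
  "f \<in> cpoly \<Longrightarrow> g \<in> cpoly \<Longrightarrow> star_coeff L k ((\<lambda>_. c) * f) g = (\<lambda>_. c) * star_coeff L k f g"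
  by (simp add: star_coeff_alt normal_op_casimir_left const_casimirs mult.left_commute)

lemma star_coeff_const_right:
  "f \<in> cpoly \<Longrightarrow> g \<in> cpoly \<Longrightarrow> star_coeff L k f ((\<lambda>_. c) * g) = (\<lambda>_. c) * star_coeff L k f g"
  by (simp add: star_coeff_alt normal_op_casimir_right const_casimirs mult.left_commute)

text \<open>Both sides expand into the same finite sum over exponents \<open>i\<close> of
  \<open>F\<close>, \<open>j\<close> of \<open>G\<close> and an order \<open>k\<close>, each term
  carrying the corresponding powers of \<open>c\<close>.\<close>

lemma eval_at_star_ext:
  assumes F: "F \<in> laurent_polys cpoly" and G: "G \<in> laurent_polys cpoly" and c: "c \<noteq> 0"
  shows "eval_at c (star_ext L F G) = star_at L c (eval_at c F) (eval_at c G)"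
proof -
  obtain N where N: "\<forall>i. \<forall>k>N. \<forall>g. normal_op L k (F $$ i) g = 0"
    using laurent_polys_bound[OF F] by blast
  define A where "A = {i. F $$ i \<noteq> 0}"
  define B where "B = {j. G $$ j \<noteq> 0}"
  define M where "M = (\<lambda>(i, j, k). i + j + int k) ` (A \<times> B \<times> {..N})"
  have fin: "finite A" "finite B" "finite M"
    using laurent_polysD(2)[OF F] laurent_polysD(2)[OF G] by (simp_all add: A_def B_def M_def)
  have Fc: "F $$ i \<in> cpoly" and Gc: "G $$ j \<in> cpoly" for i j
    using F G by (simp_all add: laurent_polysD(1))
  have evF: "eval_at c F = (\<Sum>i\<in>A. (\<lambda>_. c powi i) * F $$ i)"
    by (rule eval_at_finite) (simp_all add: fin, simp add: A_def)
  have evG: "eval_at c G = (\<Sum>j\<in>B. (\<lambda>_. c powi j) * G $$ j)"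
    by (rule eval_at_finite) (simp_all add: fin, simp add: B_def)
  have box: "star_ext L F G $$ m = (\<Sum>i\<in>A. \<Sum>j\<in>B. star L (F $$ i) (G $$ j) $$ (m - i - j))" for m
    by (rule star_ext_nth_box) (simp_all add: fin, simp add: A_def B_def)
  have inner: "(\<Sum>m\<in>M. (\<lambda>_. c powi m) * star L (F $$ i) (G $$ j) $$ (m - i - j)) =
      (\<Sum>k\<le>N. (\<lambda>_. c powi i) * ((\<lambda>_. c powi j) * ((\<lambda>_. c ^ k) * star_coeff L k (F $$ i) (G $$ j))))"
    if ij: "i \<in> A" "j \<in> B" for i j
  proof -
    have "(\<Sum>m\<in>M. (\<lambda>_. c powi m) * star L (F $$ i) (G $$ j) $$ (m - i - j)) =
        (\<Sum>m\<in>(\<lambda>k. i + j + int k) ` {..N}. (\<lambda>_. c powi m) * star L (F $$ i) (G $$ j) $$ (m - i - j))"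
    \<comment> \<open>For fixed \<open>i\<close> and \<open>j\<close>, an exponent outside this
      image leaves an order that is negative or greater than \<open>N\<close>, and its term is
      zero.\<close>
    proof (rule sum.mono_neutral_right[OF fin(3)])
      show "(\<lambda>k. i + j + int k) ` {..N} \<subseteq> M" using ij by (force simp: M_def)
      show "\<forall>m\<in>M - (\<lambda>k. i + j + int k) ` {..N}.
          (\<lambda>_. c powi m) * star L (F $$ i) (G $$ j) $$ (m - i - j) = 0"
      proof
        fix m assume m: "m \<in> M - (\<lambda>k. i + j + int k) ` {..N}"
        have "star L (F $$ i) (G $$ j) $$ (m - i - j) = 0"
        proof (cases "m - i - j < 0")
          case False
          then have "m = i + j + int (nat (m - i - j))" by simp
          with m have "nat (m - i - j) > N" by (metis DiffD2 atMost_iff imageI not_le)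
          with N False show ?thesis by (simp add: star_nth star_coeff_alt)
        qed (simp add: star_nth)
        then show "(\<lambda>_. c powi m) * star L (F $$ i) (G $$ j) $$ (m - i - j) = 0" by simp
      qed
    qed
    also have "\<dots> = (\<Sum>k\<le>N. (\<lambda>_. c powi (i + j + int k)) * star_coeff L k (F $$ i) (G $$ j))"
      by (subst sum.reindex) (auto simp: inj_on_def star_nth intro!: sum.cong)
    \<comment> \<open>The exponents \<open>i\<close> and \<open>j\<close> may be negative, so
      splitting the power relies on \<open>c\<close> being nonzero.\<close>
    also have "\<dots> = (\<Sum>k\<le>N. (\<lambda>_. c powi i) * ((\<lambda>_. c powi j) * ((\<lambda>_. c ^ k) * star_coeff L k (F $$ i) (G $$ j))))"
      using c by (intro sum.cong refl) (simp add: fun_eq_iff fun_apply_simps power_int_add)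
    finally show ?thesis .
  qed
  have "eval_at c (star_ext L F G) = (\<Sum>m\<in>M. (\<lambda>_. c powi m) * star_ext L F G $$ m)"
    using star_ext_support[OF F G N] by (intro eval_at_finite fin) (simp add: M_def A_def B_def)
  also have "\<dots> = (\<Sum>m\<in>M. \<Sum>i\<in>A. \<Sum>j\<in>B. (\<lambda>_. c powi m) * star L (F $$ i) (G $$ j) $$ (m - i - j))"
    by (simp add: box sum_distrib_left)
  also have "\<dots> = (\<Sum>i\<in>A. \<Sum>j\<in>B. \<Sum>m\<in>M. (\<lambda>_. c powi m) * star L (F $$ i) (G $$ j) $$ (m - i - j))"
    by (subst sum.swap, rule sum.cong[OF refl], rule sum.swap)
  also have "\<dots> = (\<Sum>i\<in>A. \<Sum>j\<in>B. \<Sum>k\<le>N.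
      (\<lambda>_. c powi i) * ((\<lambda>_. c powi j) * ((\<lambda>_. c ^ k) * star_coeff L k (F $$ i) (G $$ j))))"
    using inner by (intro sum.cong refl)
  also have "\<dots> = (\<Sum>k\<le>N. \<Sum>i\<in>A. \<Sum>j\<in>B.
      (\<lambda>_. c powi i) * ((\<lambda>_. c powi j) * ((\<lambda>_. c ^ k) * star_coeff L k (F $$ i) (G $$ j))))"
    by (rule trans[OF sum.cong[OF refl sum.swap] sum.swap])
  also have "\<dots> = (\<Sum>k\<le>N. (\<lambda>_. c ^ k) * star_coeff L k (eval_at c F) (eval_at c G))"
  proof (rule sum.cong[OF refl])
    fix k
    have "star_coeff L k (eval_at c F) (eval_at c G) = (\<Sum>i\<in>A. \<Sum>j\<in>B.
        star_coeff L k ((\<lambda>_. c powi i) * F $$ i) ((\<lambda>_. c powi j) * G $$ j))"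
      unfolding evF evG star_coeff_alt
      by (simp add: normal_op_sum_left normal_op_sum_right cpoly_sum cpoly_mult cpoly.const Fc Gc
          sum_distrib_left) (rule sum.swap)
    also have "\<dots> = (\<Sum>i\<in>A. \<Sum>j\<in>B. (\<lambda>_. c powi i) * ((\<lambda>_. c powi j) * star_coeff L k (F $$ i) (G $$ j)))"
      by (simp add: star_coeff_const_left star_coeff_const_right cpoly_mult cpoly.const Fc Gc
          mult.left_commute)
    finally show "(\<Sum>i\<in>A. \<Sum>j\<in>B.
      (\<lambda>_. c powi i) * ((\<lambda>_. c powi j) * ((\<lambda>_. c ^ k) * star_coeff L k (F $$ i) (G $$ j)))) =
      (\<lambda>_. c ^ k) * star_coeff L k (eval_at c F) (eval_at c G)"
      by (simp add: sum_distrib_left mult.left_commute)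
  qed
  also have "\<dots> = star_at L c (eval_at c F) (eval_at c G)"
  proof (rule star_at_finite[symmetric], intro allI impI)
    fix k assume k: "k > N"
    have "eval_at c G \<in> cpoly"
      unfolding evG by (intro cpoly_sum cpoly_mult cpoly.const Gc)
    then show "normal_op L k (eval_at c F) (eval_at c G) = 0"
      unfolding evF using N k
      by (simp add: normal_op_sum_left cpoly_mult cpoly.const Fc normal_op_casimir_left const_casimirs)
  qed
  finally show ?thesis .
qed

lemma star_at_eq_eval_at:
  assumes "f \<in> cpoly" "g \<in> cpoly" "c \<noteq> 0"
  shows "star_at L c f g = eval_at c (star_ext L (fls_const f) (fls_const g))"
  using assms by (simp add: eval_at_star_ext fls_const_laurent_polys eval_at_fls_const)

text \<open>The linear laws are read off from terminating sums. Associativity is transported from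
  the formal product: polynomials are evaluations of constant Laurent polynomials, and evaluation is
  multiplicative.\<close>

lemma bilinear_assoc_star_at:
  assumes c: "c \<noteq> 0"
  shows "bilinear_assoc_on UNIV fscale cpoly (star_at L c)"
proof -
  have closed: "star_at L c f g \<in> cpoly" if fg: "f \<in> cpoly" "g \<in> cpoly" for f g
  proof -
    obtain N where "\<forall>k>N. \<forall>g. normal_op L k f g = 0"
      using normal_op_eventually_0[OF fg(1)] by blast
    then have "star_at L c f g = (\<Sum>k\<le>N. (\<lambda>_. c ^ k) * star_coeff L k f g)"
      by (intro star_at_finite) blast
    then show ?thesis
      using fg by (simp add: cpoly_sum cpoly_mult cpoly.const star_coeff_cpoly)
  qed
  have addl: "star_at L c (f + g) h = star_at L c f h + star_at L c g h"
    if fgh: "f \<in> cpoly" "g \<in> cpoly" "h \<in> cpoly" for f g h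
  proof -
    obtain M N where MN: "\<forall>k>M. \<forall>h. normal_op L k f h = 0" "\<forall>k>N. \<forall>h. normal_op L k g h = 0"
      using normal_op_eventually_0[OF fgh(1)] normal_op_eventually_0[OF fgh(2)] by blast
    \<comment> \<open>Termination is controlled by the left factor, so one bound has to serve
      \<open>f\<close>, \<open>g\<close> and their sum.\<close>
    have "star_at L c u h = (\<Sum>k\<le>max M N. (\<lambda>_. c ^ k) * star_coeff L k u h)" if "u \<in> {f, g, f + g}" for u
      by (rule star_at_finite) (use that MN fgh in \<open>auto simp: normal_op_add_left\<close>)
    then show ?thesis
      using fgh by (simp add: star_coeff_alt normal_op_add_left distrib_left sum.distrib)
  qed
  have addr: "star_at L c h (f + g) = star_at L c h f + star_at L c h g"
    if fgh: "f \<in> cpoly" "g \<in> cpoly" "h \<in> cpoly" for f g h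
  proof -
    obtain N where N: "\<forall>k>N. \<forall>g. normal_op L k h g = 0"
      using normal_op_eventually_0[OF fgh(3)] by blast
    have "star_at L c h u = (\<Sum>k\<le>N. (\<lambda>_. c ^ k) * star_coeff L k h u)" for u
      by (rule star_at_finite) (use N in blast)
    then show ?thesis
      using fgh by (simp add: star_coeff_alt normal_op_add_right distrib_left sum.distrib)
  qed
  have fscale: "fscale x f = (\<lambda>_. x) * f" for x and f :: "complex ^ 'n \<Rightarrow> complex"
    by (simp add: fscale_def fun_eq_iff fun_apply_simps)
  have scale: "star_at L c (fscale x f) g = fscale x (star_at L c f g) \<and>
      star_at L c f (fscale x g) = fscale x (star_at L c f g)"
    if fg: "f \<in> cpoly" "g \<in> cpoly" for x f g
  proof -
    obtain N where N: "\<forall>k>N. \<forall>g. normal_op L k f g = 0"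
      using normal_op_eventually_0[OF fg(1)] by blast
    have "star_at L c f u = (\<Sum>k\<le>N. (\<lambda>_. c ^ k) * star_coeff L k f u)" for u
      by (rule star_at_finite) (use N in blast)
    moreover have "star_at L c (fscale x f) g = (\<Sum>k\<le>N. (\<lambda>_. c ^ k) * star_coeff L k (fscale x f) g)"
      by (rule star_at_finite)
        (use N fg in \<open>simp add: fscale normal_op_casimir_left const_casimirs\<close>)
    ultimately show ?thesis
      using fg by (simp add: fscale star_coeff_const_left star_coeff_const_right sum_distrib_left
          mult.left_commute)
  qed
  have assoc: "star_at L c (star_at L c f g) h = star_at L c f (star_at L c g h)"
    if "f \<in> cpoly" "g \<in> cpoly" "h \<in> cpoly" for f g h
  proof -
    have polys: "fls_const u \<in> laurent_polys cpoly" if "u \<in> {f, g, h}" for u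
      using that \<open>f \<in> cpoly\<close> \<open>g \<in> cpoly\<close> \<open>h \<in> cpoly\<close> by (auto intro: fls_const_laurent_polys)
    have "star_at L c (star_at L c f g) h =
        star_at L c (eval_at c (star_ext L (fls_const f) (fls_const g))) (eval_at c (fls_const h))"
      using that c by (simp add: star_at_eq_eval_at eval_at_fls_const)
    also have "\<dots> = eval_at c (star_ext L (star_ext L (fls_const f) (fls_const g)) (fls_const h))"
      by (intro eval_at_star_ext[symmetric] star_ext_laurent_polys polys c) simp_all
    also have "\<dots> = eval_at c (star_ext L (fls_const f) (star_ext L (fls_const g) (fls_const h)))"
      by (subst star_ext_assoc) (simp_all add: that cpoly_0)
    also have "\<dots> = star_at L c (eval_at c (fls_const f)) (eval_at c (star_ext L (fls_const g) (fls_const h)))"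
      by (intro eval_at_star_ext star_ext_laurent_polys polys c) simp_all
    also have "\<dots> = star_at L c f (star_at L c g h)"
      using that c by (simp add: star_at_eq_eval_at eval_at_fls_const)
    finally show ?thesis .
  qed
  show ?thesis
    unfolding bilinear_assoc_on_def by (simp add: closed addl addr scale assoc)
qed

section \<open>Degrees of the products\<close>

lemma star_coeff_homog:
  assumes "\<And>a b. L a b \<in> homog 2" "f \<in> homog d" "g \<in> homog e"
  shows "star_coeff L k f g \<in> homog (d + e)"
  using homog_mult[OF homog_const normal_op_homog[OF assms]]
  by (simp add: star_coeff_alt)

lemma star_at_homog:
  assumes "\<And>a b. L a b \<in> homog 2" and fg: "f \<in> homog d" "g \<in> homog e"
  shows "star_at L c f g \<in> homog (d + e)"
proof -
  obtain N where "\<forall>k>N. \<forall>g. normal_op L k f g = 0"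
    using normal_op_eventually_0[OF homog_cpoly[OF fg(1)]] by blast
  then have "star_at L c f g = (\<Sum>k\<le>N. (\<lambda>_. c ^ k) * star_coeff L k f g)"
    by (intro star_at_finite) blast
  moreover have "(\<lambda>_. c ^ k) * star_coeff L k f g \<in> homog (d + e)" for k
    using homog_mult[OF homog_const star_coeff_homog[OF assms]] by simp
  ultimately show ?thesis by (simp add: homog_sum)
qed

lemma star_ext_homog:
  assumes "\<And>a b. L a b \<in> homog 2" "\<forall>i. F $$ i \<in> homog d" "\<forall>j. G $$ j \<in> homog e"
  shows "star_ext L F G $$ m \<in> homog (d + e)"
  unfolding star_ext_nth
  using assms by (intro homog_sum) (simp add: star_nth star_coeff_homog homog_0)

end

theorem theorem1p2:
  fixes \<Lambda> :: "'n::finite \<Rightarrow> 'n \<Rightarrow> complex ^ 'n \<Rightarrow> complex"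
  assumes coeffs: "\<And>a b. \<Lambda> a b \<in> H0 2"
    and skew: "\<And>a b z. \<Lambda> a b z = - \<Lambda> b a z"
    and jac: "jacobi \<Lambda>"
    and ops: "\<And>k V f g z. k \<ge> 1 \<Longrightarrow> open V \<Longrightarrow> 0 \<notin> V \<Longrightarrow>
        holomorphic_sev f V \<Longrightarrow> holomorphic_sev g V \<Longrightarrow> z \<in> V \<Longrightarrow>
        iterated_op \<Lambda> k f g z = normal_op \<Lambda> k f g z"
  shows
    "bilinear_assoc_on (laurent_series UNIV) lscale (laurent_series sum_H0) (star_ext \<Lambda>) \<and>
     bilinear_assoc_on (laurent_polys UNIV) lscale (laurent_polys sum_H0) (star_ext \<Lambda>) \<and>
     (\<forall>f\<in>sum_H0. \<forall>g\<in>sum_H0. star_ext \<Lambda> (fls_const f) (fls_const g) = star \<Lambda> f g) \<and>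
     (\<forall>k l. \<forall>F\<in>laurent_series (H0 k). \<forall>G\<in>laurent_series (H0 l).
        star_ext \<Lambda> F G \<in> laurent_series (H0 (k + l))) \<and>
     (\<forall>c. c \<noteq> 0 \<longrightarrow>
        bilinear_assoc_on UNIV fscale sum_H0 (star_at \<Lambda> c) \<and>
        (\<forall>k l. \<forall>f\<in>H0 k. \<forall>g\<in>H0 l. star_at \<Lambda> c f g \<in> H0 (k + l)) \<and>
        (\<forall>F\<in>laurent_polys sum_H0. \<forall>G\<in>laurent_polys sum_H0.
           eval_at c (star_ext \<Lambda> F G) = star_at \<Lambda> c (eval_at c F) (eval_at c G)))"
proof -
  have quadratic: "\<Lambda> a b \<in> homog 2" for a b
    using coeffs[of a b] unfolding H0_eq_homog by simp
  interpret casimir_coefficients \<Lambda>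
  proof (rule casimir_coefficientsI[OF quadratic _ jac])
    show "\<Lambda> a b = - \<Lambda> b a" for a b
      by (rule ext) (simp add: uminus_apply skew[of a b])
    \<comment> \<open>Polynomials are holomorphic on the punctured space, so the operator identity
      can be applied with this open set.\<close>
    show "iterated_op \<Lambda> 2 f g z = normal_op \<Lambda> 2 f g z" if "f \<in> cpoly" "g \<in> cpoly" "z \<noteq> 0" for f g z
      using that by (intro ops[of 2 "- {0}"]) (auto intro: cpoly_holomorphic)
  qed
  show ?thesis
    unfolding sum_H0_eq_cpoly H0_eq_homog of_nat_add
    using bilinear_assoc_laurent_series bilinear_assoc_laurent_polys bilinear_assoc_star_at
      star_at_homog[OF quadratic] star_ext_homog[OF quadratic] eval_at_star_ext star_ext_fls_const
    by (auto simp: laurent_series_def)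
qed

end
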